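(* Assume $T\ge 3$ and that there are constants $\gamma_t\ge 0$ ($t=0,\dots,T-1$) with $|C_t(x)-C_t(y)|\le\gamma_t|x-y|$ for all $x,y$. Then for every $x$ with $z_{k-1}<x\le z_k$, $z_k\in Z_\theta$, $$|v^\pi_0(x)-v_0(x)|\le\bar\omega_0(z_k)+\bar\epsilon_0(z_k)\le U^\omega_0(z_k)+U^\epsilon_0(z_k)\le\bar U^\omega_0(\theta)+\bar U^\epsilon_0(\theta).$$ In particular $\sup_x|v^\pi_0(x)-v_0(x)|\to 0$ as $\theta\to 0$.
   Context: Model. Fix an integer horizon $T$, a discount factor $\alpha\in(0,1]$, and for $t=0,\dots,T-1$: unit ordering costs $c_t\in\mathbb R$, a salvage coefficient $c_T\in\mathbb R$, setup costs $K_t\ge 0$, functions $G_t:\mathbb R\to\mathbb R$, and independent nonnegative random demands $D_0,\dots,D_{T-1}$ with right-continuous distribution functions $F_t$ and finite means; all expectations appearing are assumed finite. Let $\delta(z)=1$ for $z>0$, $\delta(0)=0$. Put $C_t(y)=(c_t-\alpha c_{t+1})y+G_t(y)+\alpha c_{t+1}E[D_t]$. Standing assumptions: (i) each $C_t$ is convex with $C_t(y)\to+\infty$ as $|y|\to\infty$; (ii) $K_t\ge \alpha K_{t+1}$ for $t=0,\dots,T-2$. Optimal costs: $v_T(x)=-c_Tx$, $v_t(x)=\min_{y\ge x}\{K_t\delta(y-x)+c_t(y-x)+G_t(y)+\alpha E[v_{t+1}(y-D_t)]\}$. Grid construction. Fix $\theta>0$, $z_m=m\theta$, $Z_\theta=\{z_m:m\in\mathbb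 Z\}$, $f_t(n)=F_t(z_{n+1})-F_t(z_n)$ ($n\ge -1$). $C^m_t=\min\{y: C_t(y)=\min_x C_t(x)\}$; with $z_{n_0}<C^m_t\le z_{n_0+1}$, $S^U_t=\min\{z_m\in Z_\theta: z_m\ge C^m_t,\ C_t(z_m)>C_t(z_{n_0})+K_t\}$. $s_{T-1}$ is a point with $s_{T-1}\le C^m_{T-1}$, $C_{T-1}(s_{T-1})=C_{T-1}(C^m_{T-1})+K_{T-1}$; $\bar I_{T-1}=s_{T-1}$. For $t=T-2,\dots,0$: $I_t=\max\{z_m\in Z_\theta: z_m<\min(\bar I_{t+1}-\theta,C^m_t)\}$, $\bar I_t=\max\{z_m\in Z_\theta: z_m\le I_t,\ C_t(z_m)>C_t(I_t)+K_t\}+\theta$. $H_{T-1}=C_{T-1}$, $S_{T-1}=C^m_{T-1}$; $V_t(y)=H_t(S_t)+K_t$ for $y<s_t$, $V_t(y)=H_t(y)$ for $y\ge s_t$. For $t=T-2,\dots,0$: $H_t(y)=C_t(y)+\alpha\sum_{n=-1}^\infty V_{t+1}(y-z_n)f_t(n)$; $S_t=\max\{z_m\in Z_\theta: I_t\le z_m\le S^U_t,\ H_t(z_m)=\min\{H_t(z_n):z_n\in Z_\theta, I_t\le z_n\le S^U_t\}\}$; $s_t=S_t$ if $K_t=0$, else $s_t=\min\{z_m\in Z_\theta:\bar I_t\le z_m\le S_t,\ H_t(z_m)\le H_t(S_t)+K_t\}$. Policy cost. $v^\pi_T(x)=-c_Tx$ and, for $t\le T-1$, with $y_t(x)=S_t$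 if $x<s_t$ and $y_t(x)=x$ otherwise, $v^\pi_t(x)=K_t\delta(y_t(x)-x)+c_t(y_t(x)-x)+G_t(y_t(x))+\alpha E[v^\pi_{t+1}(y_t(x)-D_t)]$. Estimate functions. $\psi_{T-1}(x,y)=\bar\psi_{T-1}(x,y)=\gamma_{T-1}x$; $\varphi_{T-1}(x,y)=\bar\varphi_{T-1}(x,y)=0$ if $y<s_{T-1}$ and $=\gamma_{T-1}x$ if $y\ge s_{T-1}$. For $t=0,\dots,T-2$, with $n$ the integer such that $z_{n-1}\le y-s_{t+1}<z_n$: $\psi_t(x,y)=\gamma_tx$ if $y<s_{t+1}-\theta$, else $\psi_t(x,y)=\gamma_tx+\alpha\sum_{m=-1}^{n-1}\varphi_{t+1}(x,y-z_m)f_t(m)$; $\varphi_t(x,y)=0$ if $y<s_t$, $=\psi_t(y-s_t,y)$ if $y\ge s_t$ and $y-x<s_t$, $=\psi_t(x,y)$ if $y\ge s_t$ and $y-x\ge s_t$. Likewise $\bar\psi_t(x,y)=\gamma_tx$ if $y<s_{t+1}-\theta$, else $\bar\psi_t(x,y)=\gamma_tx+\alpha\sum_{m=-1}^{n-1}\bar\varphi_{t+1}(x,y-z_m)f_t(m)$; $\bar\varphi_t(x,y)=0$ if $y<s_t$, $=\bar\psi_t(y-s_t+\theta,y)$ if $y\ge s_t$ and $y-x<s_t$, $=\bar\psi_t(x,y)$ if $y\ge s_t$ and $y-x\ge s_t$. Error-bound functions. $\omega_{T-1}\equiv\bar\omega_{T-1}\equiv 0$, $\eta_{T-1}=0$.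 For $t=T-2,\dots,0$: $\omega_t(x)=\psi_t(\theta,x)-\gamma_t\theta+\alpha\sum_{n=-1}^\infty\bar\omega_{t+1}(x-z_n)f_t(n)$; $\eta_t=\bar\psi_t(\theta,S^U_t)+\omega_t(S^U_t)$; $\bar\omega_t(x)=\eta_t$ if $x\le S^U_t$ and $\bar\omega_t(x)=\max(\eta_t,\omega_t(x))$ if $x>S^U_t$. For $z_k\in Z_\theta$: $\bar\epsilon_{T-2}(z_k)=\alpha\gamma_{T-1}\theta$ and for $t=0,\dots,T-3$, $\bar\epsilon_t(z_k)=\alpha^{T-1-t}\gamma_{T-1}\theta+\sum_{i=0}^{T-3-t}2\alpha^i[\bar\psi_{t+i}(\theta,\max(\lambda_t(i),S_{t+i}))-\gamma_{t+i}\theta]$, with $\lambda_t(0)=z_k$, $\lambda_t(i)=\max(\lambda_t(i-1),S_{t+i-1})+\theta$. Simple bounds (at $t=0$). With $\mu_0(0)=z_k$, $\mu_0(i)=\max(\mu_0(i-1),S^U_{i-1})+\theta$: $U^\omega_0(z_k)=\theta\sum_{i=0}^{T-2}\alpha^i\gamma_i+\theta\sum_{i=0}^{T-2}\sum_{n=1}^{T-1-i}\alpha^{n+i}\gamma_{i+n}\big[\prod_{m=0}^{n-1}F_{i+m}(S^U_i+(m+1)\theta-s_{i+m+1})+\prod_{m=0}^{n-1}F_{i+m}(\max(\mu_0(i),S^U_i)+(m+1)\theta-s_{i+m+1})\big]$; $\bar U^\omega_0(\theta)=\theta\sum_{i=0}^{T-2}\alpha^i\gamma_i+2\theta\sum_{i=0}^{T-2}\sum_{n=1}^{T-1-i}\alpha^{n+i}\gamma_{i+n}$;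 $U^\epsilon_0(z_k)=\alpha^{T-1}\gamma_{T-1}\theta+2\theta\sum_{i=0}^{T-3}\sum_{n=1}^{T-1-i}\alpha^{n+i}\gamma_{i+n}\prod_{m=0}^{n-1}F_{i+m}(\max(\lambda_0(i),S_i)+(m+1)\theta-s_{i+m+1})$; $\bar U^\epsilon_0(\theta)=\alpha^{T-1}\gamma_{T-1}\theta+2\theta\sum_{i=0}^{T-3}\sum_{n=1}^{T-1-i}\alpha^{n+i}\gamma_{i+n}$. *)

theory Defs
  imports "HOL-Probability.Probability"
begin

text \<open>The data of the inventory model: horizon T, discount factor alpha,
unit ordering costs c_0..c_T (c_T is the salvage coefficient), setup costs K_t,
functions G_t and the distributions of the demands D_t (as probability measures on the reals).\<close>

record invmodel =
  hor   :: nat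
  disc  :: real
  ucost :: "nat \<Rightarrow> real"
  scost :: "nat \<Rightarrow> real"
  Gf    :: "nat \<Rightarrow> real \<Rightarrow> real"
  dem   :: "nat \<Rightarrow> real measure"

definition cdf :: "invmodel \<Rightarrow> nat \<Rightarrow> real \<Rightarrow> real" where
  "cdf M t x = measure (dem M t) {..x}"

definition Cf :: "invmodel \<Rightarrow> nat \<Rightarrow> real \<Rightarrow> real" where
  "Cf M t y = (ucost M t - disc M * ucost M (Suc t)) * y + Gf M t y
              + disc M * ucost M (Suc t) * (\<integral>d. d \<partial>dem M t)"

definition dlt :: "real \<Rightarrow> real" where
  "dlt z = (if z > 0 then 1 else 0)"

definition stagecost :: "invmodel \<Rightarrow> nat \<Rightarrow> real \<Rightarrow> real \<Rightarrow> real" where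
  "stagecost M t x y = scost M t * dlt (y - x) + ucost M t * (y - x) + Gf M t y"

text \<open>Optimal costs; index k = number of remaining periods, i.e. t = T - k.\<close>
primrec vr :: "invmodel \<Rightarrow> nat \<Rightarrow> real \<Rightarrow> real" where
  "vr M 0 x = - ucost M (hor M) * x"
| "vr M (Suc k) x = (let t = hor M - Suc k in
      (INF y\<in>{x..}. stagecost M t x y + disc M * (\<integral>d. vr M k (y - d) \<partial>dem M t)))"

definition vopt :: "invmodel \<Rightarrow> nat \<Rightarrow> real \<Rightarrow> real" where
  "vopt M t x = vr M (hor M - t) x"

definition zg :: "real \<Rightarrow> int \<Rightarrow> real" where
  "zg th m = th * of_int m"

definition fg :: "invmodel \<Rightarrow> real \<Rightarrow> nat \<Rightarrow> int \<Rightarrow> real" where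
  "fg M th t n = cdf M t (zg th (n + 1)) - cdf M t (zg th n)"

definition Cmin :: "invmodel \<Rightarrow> nat \<Rightarrow> real" where
  "Cmin M t = Inf {y. \<forall>x. Cf M t y \<le> Cf M t x}"

text \<open>n0 is the integer with z_{n0} < C^m_t \<le> z_{n0+1}.\<close>
definition n0 :: "invmodel \<Rightarrow> real \<Rightarrow> nat \<Rightarrow> int" where
  "n0 M th t = \<lceil>Cmin M t / th\<rceil> - 1"

definition SU :: "invmodel \<Rightarrow> real \<Rightarrow> nat \<Rightarrow> real" where
  "SU M th t = zg th (LEAST m. Cmin M t \<le> zg th m \<and>
       Cf M t (zg th m) > Cf M t (zg th (n0 M th t)) + scost M t)"

definition sLast :: "invmodel \<Rightarrow> real" where
  "sLast M = (THE s. s \<le> Cmin M (hor M - 1) \<and>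
       Cf M (hor M - 1) s = Cf M (hor M - 1) (Cmin M (hor M - 1)) + scost M (hor M - 1))"

definition Igrid :: "invmodel \<Rightarrow> real \<Rightarrow> nat \<Rightarrow> real \<Rightarrow> real" where
  "Igrid M th t b = zg th (GREATEST m. zg th m < min (b - th) (Cmin M t))"

definition Ibgrid :: "invmodel \<Rightarrow> real \<Rightarrow> nat \<Rightarrow> real \<Rightarrow> real" where
  "Ibgrid M th t i = zg th (GREATEST m. zg th m \<le> i \<and> Cf M t (zg th m) > Cf M t i + scost M t) + th"

text \<open>Ibr M th k = bar-I_{T-1-k}.\<close>
primrec Ibr :: "invmodel \<Rightarrow> real \<Rightarrow> nat \<Rightarrow> real" where
  "Ibr M th 0 = sLast M"
| "Ibr M th (Suc k) = (let t = hor M - 2 - k in Ibgrid M th t (Igrid M th t (Ibr M th k)))"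

definition Ibar :: "invmodel \<Rightarrow> real \<Rightarrow> nat \<Rightarrow> real" where
  "Ibar M th t = Ibr M th (hor M - 1 - t)"

definition Ig :: "invmodel \<Rightarrow> real \<Rightarrow> nat \<Rightarrow> real" where
  "Ig M th t = Igrid M th t (Ibar M th (Suc t))"

text \<open>HSs M th k = (H_t, S_t, s_t) for t = T-1-k.  The sum over n = -1,0,1,... is
written as a series over j = n+1 :: nat.\<close>
primrec HSs :: "invmodel \<Rightarrow> real \<Rightarrow> nat \<Rightarrow> (real \<Rightarrow> real) \<times> real \<times> real" where
  "HSs M th 0 = (Cf M (hor M - 1), Cmin M (hor M - 1), sLast M)"
| "HSs M th (Suc k) =
     (let t = hor M - 2 - k;
          H' = fst (HSs M th k); S' = fst (snd (HSs M th k)); s' = snd (snd (HSs M th k));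
          V' = (\<lambda>y. if y < s' then H' S' + scost M (Suc t) else H' y);
          Hn = (\<lambda>y. Cf M t y + disc M *
                  (\<Sum>j. V' (y - zg th (int j - 1)) * fg M th t (int j - 1)));
          Sn = zg th (GREATEST m. Ig M th t \<le> zg th m \<and> zg th m \<le> SU M th t \<and>
                 (\<forall>n. Ig M th t \<le> zg th n \<and> zg th n \<le> SU M th t \<longrightarrow> Hn (zg th m) \<le> Hn (zg th n)));
          sn = (if scost M t = 0 then Sn
                else zg th (LEAST m. Ibar M th t \<le> zg th m \<and> zg th m \<le> Sn \<and>
                                   Hn (zg th m) \<le> Hn Sn + scost M t))
      in (Hn, Sn, sn))"

definition Hf :: "invmodel \<Rightarrow> real \<Rightarrow> nat \<Rightarrow> real \<Rightarrow> real" where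
  "Hf M th t = fst (HSs M th (hor M - 1 - t))"
definition Sf :: "invmodel \<Rightarrow> real \<Rightarrow> nat \<Rightarrow> real" where
  "Sf M th t = fst (snd (HSs M th (hor M - 1 - t)))"
definition sf :: "invmodel \<Rightarrow> real \<Rightarrow> nat \<Rightarrow> real" where
  "sf M th t = snd (snd (HSs M th (hor M - 1 - t)))"

primrec vpr :: "invmodel \<Rightarrow> real \<Rightarrow> nat \<Rightarrow> real \<Rightarrow> real" where
  "vpr M th 0 x = - ucost M (hor M) * x"
| "vpr M th (Suc k) x = (let t = hor M - Suc k;
       y = (if x < sf M th t then Sf M th t else x) in
       stagecost M t x y + disc M * (\<integral>d. vpr M th k (y - d) \<partial>dem M t))"

definition vpi :: "invmodel \<Rightarrow> real \<Rightarrow> nat \<Rightarrow> real \<Rightarrow> real" where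
  "vpi M th t x = vpr M th (hor M - t) x"

text \<open>The parameter e is 0 for psi/phi and theta for the barred versions.
The upper summation index n-1 is floor((y - s_{t+1})/theta).\<close>
definition psiof :: "invmodel \<Rightarrow> real \<Rightarrow> (nat \<Rightarrow> real) \<Rightarrow> nat \<Rightarrow> (real \<Rightarrow> real \<Rightarrow> real)
                      \<Rightarrow> real \<Rightarrow> real \<Rightarrow> real" where
  "psiof M th gm t ph x y =
     (if y < sf M th (Suc t) - th then gm t * x
      else gm t * x + disc M *
        (\<Sum>m\<in>{-1..\<lfloor>(y - sf M th (Suc t)) / th\<rfloor>}. ph x (y - zg th m) * fg M th t m))"

text \<open>phr M th gm e k = phi_t (e = 0) or bar-phi_t (e = theta) for t = T-1-k.\<close>
primrec phr :: "invmodel \<Rightarrow> real \<Rightarrow> (nat \<Rightarrow> real) \<Rightarrow> real \<Rightarrow> nat \<Rightarrow> real \<Rightarrow> real \<Rightarrow> real" where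
  "phr M th gm e 0 = (\<lambda>x y. if y < sf M th (hor M - 1) then 0 else gm (hor M - 1) * x)"
| "phr M th gm e (Suc k) = (let t = hor M - 2 - k; ps = psiof M th gm t (phr M th gm e k) in
     (\<lambda>x y. if y < sf M th t then 0
            else if y - x < sf M th t then ps (y - sf M th t + e) y
            else ps x y))"

definition psig :: "invmodel \<Rightarrow> real \<Rightarrow> (nat \<Rightarrow> real) \<Rightarrow> real \<Rightarrow> nat \<Rightarrow> real \<Rightarrow> real \<Rightarrow> real" where
  "psig M th gm e t = (if t = hor M - 1 then (\<lambda>x y. gm t * x)
                        else psiof M th gm t (phr M th gm e (hor M - 2 - t)))"

definition psi :: "invmodel \<Rightarrow> real \<Rightarrow> (nat \<Rightarrow> real) \<Rightarrow> nat \<Rightarrow> real \<Rightarrow> real \<Rightarrow> real" where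
  "psi M th gm t = psig M th gm 0 t"
definition psibar :: "invmodel \<Rightarrow> real \<Rightarrow> (nat \<Rightarrow> real) \<Rightarrow> nat \<Rightarrow> real \<Rightarrow> real \<Rightarrow> real" where
  "psibar M th gm t = psig M th gm th t"

text \<open>omr M th gm k = bar-omega_t for t = T-1-k.\<close>
primrec omr :: "invmodel \<Rightarrow> real \<Rightarrow> (nat \<Rightarrow> real) \<Rightarrow> nat \<Rightarrow> real \<Rightarrow> real" where
  "omr M th gm 0 = (\<lambda>x. 0)"
| "omr M th gm (Suc k) = (let t = hor M - 2 - k;
       om = (\<lambda>x. psi M th gm t th x - gm t * th + disc M *
              (\<Sum>j. omr M th gm k (x - zg th (int j - 1)) * fg M th t (int j - 1)));
       eta = psibar M th gm t th (SU M th t) + om (SU M th t)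
     in (\<lambda>x. if x \<le> SU M th t then eta else max eta (om x)))"

definition ombar :: "invmodel \<Rightarrow> real \<Rightarrow> (nat \<Rightarrow> real) \<Rightarrow> nat \<Rightarrow> real \<Rightarrow> real" where
  "ombar M th gm t = omr M th gm (hor M - 1 - t)"

primrec lam :: "invmodel \<Rightarrow> real \<Rightarrow> nat \<Rightarrow> real \<Rightarrow> nat \<Rightarrow> real" where
  "lam M th t z 0 = z"
| "lam M th t z (Suc i) = max (lam M th t z i) (Sf M th (t + i)) + th"

text \<open>bar-epsilon_t(z) for t \<le> T-2 (for t = T-2 the sum is empty).\<close>
definition epsbar :: "invmodel \<Rightarrow> real \<Rightarrow> (nat \<Rightarrow> real) \<Rightarrow> nat \<Rightarrow> real \<Rightarrow> real" where
  "epsbar M th gm t z = disc M ^ (hor M - 1 - t) * gm (hor M - 1) * th +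
     (\<Sum>i<hor M - 2 - t. 2 * disc M ^ i *
        (psibar M th gm (t + i) th (max (lam M th t z i) (Sf M th (t + i))) - gm (t + i) * th))"

primrec mu0 :: "invmodel \<Rightarrow> real \<Rightarrow> real \<Rightarrow> nat \<Rightarrow> real" where
  "mu0 M th z 0 = z"
| "mu0 M th z (Suc i) = max (mu0 M th z i) (SU M th i) + th"

definition Uom0 :: "invmodel \<Rightarrow> real \<Rightarrow> (nat \<Rightarrow> real) \<Rightarrow> real \<Rightarrow> real" where
  "Uom0 M th gm z = th * (\<Sum>i<hor M - 1. disc M ^ i * gm i) +
     th * (\<Sum>i<hor M - 1. \<Sum>n\<in>{1..hor M - 1 - i}. disc M ^ (n + i) * gm (i + n) *
        ((\<Prod>m<n. cdf M (i + m) (SU M th i + real (m + 1) * th - sf M th (i + m + 1))) +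
         (\<Prod>m<n. cdf M (i + m) (max (mu0 M th z i) (SU M th i) + real (m + 1) * th
                                  - sf M th (i + m + 1)))))"

definition Uombar0 :: "invmodel \<Rightarrow> (nat \<Rightarrow> real) \<Rightarrow> real \<Rightarrow> real" where
  "Uombar0 M gm th = th * (\<Sum>i<hor M - 1. disc M ^ i * gm i) +
     2 * th * (\<Sum>i<hor M - 1. \<Sum>n\<in>{1..hor M - 1 - i}. disc M ^ (n + i) * gm (i + n))"

definition Ueps0 :: "invmodel \<Rightarrow> real \<Rightarrow> (nat \<Rightarrow> real) \<Rightarrow> real \<Rightarrow> real" where
  "Ueps0 M th gm z = disc M ^ (hor M - 1) * gm (hor M - 1) * th +
     2 * th * (\<Sum>i<hor M - 2. \<Sum>n\<in>{1..hor M - 1 - i}. disc M ^ (n + i) * gm (i + n) *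
        (\<Prod>m<n. cdf M (i + m) (max (lam M th 0 z i) (Sf M th i) + real (m + 1) * th
                                 - sf M th (i + m + 1))))"

definition Uepsbar0 :: "invmodel \<Rightarrow> (nat \<Rightarrow> real) \<Rightarrow> real \<Rightarrow> real" where
  "Uepsbar0 M gm th = disc M ^ (hor M - 1) * gm (hor M - 1) * th +
     2 * th * (\<Sum>i<hor M - 2. \<Sum>n\<in>{1..hor M - 1 - i}. disc M ^ (n + i) * gm (i + n))"

end

(* With w_t(x) = v_t(x) + c_t x and u_t = v^pi_t(x) + c_t x, all cost functions are compared to the cost V_t
of the (s_t,S_t) policy under the demand rd D, the demand D rounded down to the grid with D - rd D in (0, theta].
On the grid, K-convexity shows that V_t is the optimal cost for the rounded demand.  On a closed grid
cell [z - theta, z] the oscillation of H_t, and also its deviation from the mean of its two end values, is at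
most psi-bar_t(theta, z), because V_t jumps only at the grid point s_t.

The estimate |u_t - V_t| <= epsilon-bar_t adds up the two-cell oscillations of V_{t+1} between D and rd D.
For w_t <= V_t + omega-bar_t one proves, for all n at once,
  w_t(b) <= V_t(a) + n phi_t(theta, z) + omega-bar_t(z)   for a in the cell of z and a - n theta <= b <= a,
since one period of demand enlarges the gap by one cell.  For V_t <= w_t + omega-bar_t, the critical case is an exact
order from x >= s_t to some y > x off the grid; there the mean-value estimate at x and at y, with
the grid inequality H_t(z) <= K_t + H_t(z') at both cell ends, loses just psi-bar_t(theta, S^U_t), which is part of eta_t.
The explicit bounds follow from psi-bar_t(theta, z) <= gamma_t theta + alpha F_t(z + theta - s_{t+1}) psi-bar_{t+1}(theta, z + theta). *)

theory Submission
  imports Defs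
begin

section \<open>K-convexity\<close>

text \<open>The obstacle is that K-convexity of H_t and optimality of the (s_t,S_t) rule are
  available only between grid points when t < T-1, whereas the exact problem may order up to any
  real level. Each inequality off the grid is therefore transported to the ends of a cell, at the
  price of an oscillation. Two families of oscillation bounds occur because the jump of V_t at s_t
  is downward: V_t equals H_t(S_t)+K_t to the left and H_t(s_t), which is at most that, at s_t. An
  increase of V_t from left to right never sees the jump, and psi, phi suffice; a decrease does see
  it, so the cell ending at s_t must be charged as well. This is the origin of the offset
  \<open>e\<close>: at y = s_t the barred function evaluates psi-bar at theta, while phi evaluates
  psi at 0, where it vanishes. The constant eta_t is the loss at an order. It is taken at S^U_t
  because the relevant targets of orders lie below S^U_t and the error functions are monotone on the
  grid.\<close>

lemma back_induct [consumes 1, case_names last step]: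
  fixes t T :: nat
  assumes "t < T" "P (T - 1)" "\<And>t. Suc t < T \<Longrightarrow> P (Suc t) \<Longrightarrow> P t"
  shows "P t"
proof -
  have "t \<le> T - 1" using assms(1) by simp
  then show ?thesis
    using assms(2) by (rule inc_induct) (use assms(3) in auto)
qed

text \<open>\<open>int\<close> is not well-ordered, so the search is moved to \<open>nat\<close> by
  measuring the distance from the lower bound \<open>b\<close>.\<close>

lemma int_Least:
  fixes P :: "int \<Rightarrow> bool"
  assumes "P m" and b: "\<And>n. P n \<Longrightarrow> b \<le> n"
  shows "P (LEAST n. P n)" and "\<And>n. P n \<Longrightarrow> (LEAST n. P n) \<le> n"
proof -
  define k where "k = (LEAST k::nat. P (b + int k))"
  have "P (b + int (nat (m - b)))" using assms(1) b[OF assms(1)] by simp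
  then have k: "P (b + int k)" unfolding k_def by (rule LeastI)
  have kmin: "b + int k \<le> n" if "P n" for n
  proof -
    have "P (b + int (nat (n - b)))" using that b[OF that] by simp
    then have "k \<le> nat (n - b)" unfolding k_def by (rule Least_le)
    then show ?thesis using b[OF that] by linarith
  qed
  have "(LEAST n. P n) = b + int k" using k kmin by (rule Least_equality)
  then show "P (LEAST n. P n)" "\<And>n. P n \<Longrightarrow> (LEAST n. P n) \<le> n"
    using k kmin by simp_all
qed

lemma int_Greatest:
  fixes P :: "int \<Rightarrow> bool"
  assumes "P m" and b: "\<And>n. P n \<Longrightarrow> n \<le> b"
  shows "P (GREATEST n. P n)" and "\<And>n. P n \<Longrightarrow> n \<le> (GREATEST n. P n)"
proof -
  define k where "k = (LEAST k::nat. P (b - int k))"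
  have "P (b - int (nat (b - m)))" using assms(1) b[OF assms(1)] by simp
  then have k: "P (b - int k)" unfolding k_def by (rule LeastI)
  have kmax: "n \<le> b - int k" if "P n" for n
  proof -
    have "P (b - int (nat (b - n)))" using that b[OF that] by simp
    then have "k \<le> nat (b - n)" unfolding k_def by (rule Least_le)
    then show ?thesis using b[OF that] by linarith
  qed
  have "(GREATEST n. P n) = b - int k" using k kmax by (rule Greatest_equality)
  then show "P (GREATEST n. P n)" "\<And>n. P n \<Longrightarrow> n \<le> (GREATEST n. P n)"
    using k kmax by simp_all
qed

lemma convex_on_three_points:
  fixes f :: "real \<Rightarrow> real"
  assumes "convex_on UNIV f" "u \<le> v" "v \<le> w"
  shows "(w - u) * f v \<le> (w - v) * f u + (v - u) * f w"
proof (cases "u = w")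
  case False
  then have uw: "u < w" using assms by simp
  define l where "l = (v - u) / (w - u)"
  have "l * (w - u) = v - u" using uw by (simp add: l_def)
  then have l3: "v = (1 - l) * u + l * w" by (simp add: algebra_simps)
  have l: "0 \<le> l" "l \<le> 1" using assms uw by (simp_all add: l_def)
  have "f v \<le> (1 - l) * f u + l * f w"
    using convex_onD[OF assms(1) l(1,2), of u w] l3 by simp
  then have "(w - u) * f v \<le> (w - u) * ((1 - l) * f u + l * f w)"
    using uw by (intro mult_left_mono) auto
  also have "\<dots> = ((w - u) - (w - u) * l) * f u + ((w - u) * l) * f w" by (simp add: algebra_simps)
  also have "(w - u) * l = v - u" using uw by (simp add: l_def)
  finally show ?thesis by simp
qed (use assms in auto)

text \<open>Scarf's K-convexity relative to a set \<open>X\<close>: only triples inside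
  \<open>X\<close> count, so it applies to functions that behave well on a grid only.\<close>

definition K_convex_on :: "real \<Rightarrow> real set \<Rightarrow> (real \<Rightarrow> real) \<Rightarrow> bool" where
  "K_convex_on K X f \<longleftrightarrow> (\<forall>u\<in>X. \<forall>v\<in>X. \<forall>w\<in>X. u < v \<longrightarrow> v \<le> w \<longrightarrow>
     f v + (w - v) / (v - u) * (f v - f u) \<le> K + f w)"

lemma K_convex_onD:
  "K_convex_on K X f \<Longrightarrow> u \<in> X \<Longrightarrow> v \<in> X \<Longrightarrow> w \<in> X \<Longrightarrow> u < v \<Longrightarrow> v \<le> w \<Longrightarrow>
     f v + (w - v) / (v - u) * (f v - f u) \<le> K + f w"
  unfolding K_convex_on_def by blast

lemma K_convex_on_subset: "K_convex_on K X f \<Longrightarrow> Y \<subseteq> X \<Longrightarrow> K_convex_on K Y f"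
  unfolding K_convex_on_def by blast

lemma convex_imp_K_convex_on:
  assumes "convex_on UNIV f" "0 \<le> K"
  shows "K_convex_on K X f"
  unfolding K_convex_on_def
proof (intro ballI impI)
  fix u v w :: real assume "u < v" "v \<le> w"
  then have "(w - v) * (f v - f u) \<le> (v - u) * (f w - f v)"
    using convex_on_three_points[OF assms(1), of u v w] by (simp add: algebra_simps)
  then have "(w - v) / (v - u) * (f v - f u) \<le> f w - f v"
    using \<open>u < v\<close> by (simp add: field_simps)
  then show "f v + (w - v) / (v - u) * (f v - f u) \<le> K + f w" using assms(2) by simp
qed

text \<open>\<open>X\<close> will be the grid before the last period and the whole line in it. On a
  grid the level \<open>H S + K\<close> may be skipped, so \<open>s\<close> is described by the two
  inequalities \<open>below\<close> and \<open>at\<close> instead of an equation.\<close>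

locale sS_policy =
  fixes K :: real and X :: "real set" and H :: "real \<Rightarrow> real" and s S :: real
  assumes K: "0 \<le> K" and conv: "K_convex_on K X H"
    and sX: "s \<in> X" and SX: "S \<in> X" and sS: "s \<le> S"
    and min: "\<And>z. z \<in> X \<Longrightarrow> H S \<le> H z"
    and below: "\<And>z. z \<in> X \<Longrightarrow> z < s \<Longrightarrow> H S + K \<le> H z"
    and at: "H s \<le> H S + K"
begin

definition V :: "real \<Rightarrow> real" where "V y = (if y < s then H S + K else H y)"

text \<open>For \<open>z\<close> between \<open>s\<close> and \<open>S\<close>, a value above
  \<open>K + H S\<close> would make the chord from \<open>s\<close> to \<open>z\<close> rise, and
  its extrapolation to \<open>S\<close> contradicts K-convexity. Right of \<open>S\<close> the chord
  from the minimizer \<open>S\<close> to \<open>z\<close> does not fall, and extrapolating it to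
  \<open>z'\<close> gives the bound.\<close>

lemma no_order:
  assumes "z \<in> X" "z' \<in> X" "s \<le> z" "z \<le> z'"
  shows "H z \<le> K + H z'"
proof (cases "z \<le> S")
  case True
  show ?thesis
  proof (rule ccontr)
    assume "\<not> ?thesis"
    then have gt: "H z > K + H S" using min[OF assms(2)] by simp
    with at have "s \<noteq> z" by auto
    then have "s < z" using assms by simp
    have "0 \<le> (S - z) / (z - s) * (H z - H s)"
      using gt at \<open>s < z\<close> True by (intro mult_nonneg_nonneg divide_nonneg_nonneg) auto
    with K_convex_onD[OF conv sX assms(1) SX \<open>s < z\<close> True] gt show False by simp
  qed
next
  case False
  have "0 \<le> (z' - z) / (z - S) * (H z - H S)"
    using min[OF assms(1)] False assms by (intro mult_nonneg_nonneg divide_nonneg_nonneg) auto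
  with K_convex_onD[OF conv SX assms(1,2) _ assms(4)] False show ?thesis by simp
qed

lemma V_ge: "z \<in> X \<Longrightarrow> H S \<le> V z"
  using min K by (simp add: V_def)

lemma V_le_K_plus:
  assumes "z \<in> X" "z' \<in> X" "z \<le> z'"
  shows "V z \<le> K + V z'"
  using assms no_order[of z z'] min[of z'] K by (auto simp: V_def)

lemma V_K_convex: "K_convex_on K X V"
  unfolding K_convex_on_def
proof (intro ballI impI)
  fix u v w assume X: "u \<in> X" "v \<in> X" "w \<in> X" and uv: "u < v" "v \<le> w"
  consider "v < s" | "s \<le> u" | "u < s" "s \<le> v" by linarith
  then show "V v + (w - v) / (v - u) * (V v - V u) \<le> K + V w"
  proof cases
    case 1
    then show ?thesis using V_ge[OF X(3)] uv by (simp add: V_def)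
  next
    case 2
    then show ?thesis using K_convex_onD[OF conv X uv] uv by (simp add: V_def)
  next
    case 3
    have r: "0 \<le> (w - v) / (v - u)" using uv by simp
    have "H v + (w - v) / (v - u) * (H v - (H S + K)) \<le> K + H w"
    \<comment> \<open>Either the chord of \<open>V\<close> does not rise and \<open>no_order\<close>
      suffices, or \<open>H v\<close> exceeds the level at \<open>s\<close>, and moving the left end
      from \<open>u\<close> to \<open>s\<close> only steepens the chord.\<close>
    proof (cases "H v \<le> H S + K")
      case True
      have "(w - v) / (v - u) * (H v - (H S + K)) \<le> 0"
        using True r by (intro mult_nonneg_nonpos) auto
      with no_order[OF X(2,3) 3(2) uv(2)] show ?thesis by simp
    next
      case False
      with at 3 have "s < v" by (cases "s = v") auto
      have "(w - v) / (v - u) * (H v - (H S + K)) \<le> (w - v) / (v - s) * (H v - H s)"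
        using False at \<open>s < v\<close> 3 uv
        by (intro mult_mono divide_left_mono) (auto intro!: mult_pos_pos)
      with K_convex_onD[OF conv sX X(2,3) \<open>s < v\<close> uv(2)] show ?thesis by simp
    qed
    then show ?thesis using 3 uv by (simp add: V_def)
  qed
qed

end

section \<open>The grid and the policy parameters\<close>

locale inventory_grid =
  fixes M :: invmodel and gm :: "nat \<Rightarrow> real" and th :: real
  assumes T3: "hor M \<ge> 3"
    and alpha: "0 < disc M" "disc M \<le> 1"
    and Knonneg: "\<forall>t<hor M. scost M t \<ge> 0"
    and Kdec: "\<forall>t. t + 2 \<le> hor M \<longrightarrow> scost M t \<ge> disc M * scost M (Suc t)"
    and demand: "\<forall>t<hor M. prob_space (dem M t) \<and> sets (dem M t) = sets borel \<and>
                   (AE d in dem M t. 0 \<le> d) \<and> integrable (dem M t) (\<lambda>d. d)"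
    and Cconv: "\<forall>t<hor M. convex_on UNIV (Cf M t) \<and> filterlim (Cf M t) at_top at_infinity"
    and Lip: "\<forall>t<hor M. gm t \<ge> 0 \<and> (\<forall>x y. \<bar>Cf M t x - Cf M t y\<bar> \<le> gm t * \<bar>x - y\<bar>)"
    and fin_v: "\<forall>t<hor M. \<forall>y. integrable (dem M t) (\<lambda>d. vopt M (Suc t) (y - d))"
    and fin_vpi: "\<forall>t<hor M. \<forall>y. integrable (dem M t) (\<lambda>d. vpi M th (Suc t) (y - d))"
    and th: "0 < th"
begin

abbreviation "T \<equiv> hor M"
abbreviation "\<alpha> \<equiv> disc M"
abbreviation "C \<equiv> Cf M"
abbreviation "K \<equiv> scost M"
abbreviation "H \<equiv> Hf M th"
abbreviation "S \<equiv> Sf M th"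
abbreviation "s \<equiv> sf M th"
abbreviation "Cm \<equiv> Cmin M"
abbreviation "su \<equiv> SU M th"
abbreviation "z \<equiv> zg th"

definition L :: nat where "L = T - 1"

lemma L_less [simp]: "L < T" using T3 by (simp add: L_def)
lemma Suc_L: "Suc L = T" using T3 by (simp add: L_def)
lemma eq_L: "t < T \<Longrightarrow> \<not> Suc t < T \<Longrightarrow> t = L" by (simp add: L_def)
lemma not_Suc_L [simp]: "\<not> Suc L < T" by (simp add: L_def)

lemma horizon_induct [consumes 1, case_names last step]:
  assumes "t < T" "P L" "\<And>t. Suc t < T \<Longrightarrow> P (Suc t) \<Longrightarrow> P t"
  shows "P t"
  using assms unfolding L_def by (rule back_induct)

section \<open>Grid points, cells and rounding\<close>

definition G :: "real set" where "G = range z"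

lemma z_in [simp]: "z m \<in> G" by (simp add: G_def)
lemma z_le [simp]: "z m \<le> z n \<longleftrightarrow> m \<le> n" using th by (simp add: zg_def)
lemma z_less [simp]: "z m < z n \<longleftrightarrow> m < n" using th by (simp add: zg_def)
lemma z_add: "z (m + n) = z m + z n" by (simp add: zg_def algebra_simps)
lemma z_diff: "z (m - n) = z m - z n" by (simp add: zg_def algebra_simps)
lemma z_1 [simp]: "z 1 = th" by (simp add: zg_def)

lemma G_add: "a \<in> G \<Longrightarrow> b \<in> G \<Longrightarrow> a + b \<in> G"
  unfolding G_def by (auto simp: z_add[symmetric])
lemma G_diff: "a \<in> G \<Longrightarrow> b \<in> G \<Longrightarrow> a - b \<in> G"
  unfolding G_def by (auto simp: z_diff[symmetric])
lemma th_in_G [simp]: "th \<in> G" using z_in[of 1] by simp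

lemma G_gap: "a \<in> G \<Longrightarrow> b \<in> G \<Longrightarrow> a < b \<Longrightarrow> a + th \<le> b"
proof -
  assume "a \<in> G" "b \<in> G" "a < b"
  then obtain m n where "a = z m" "b = z n" "m < n" unfolding G_def by auto
  then show ?thesis using z_le[of "m + 1" n] by (simp add: z_add)
qed

definition up :: "real \<Rightarrow> real" where "up x = z \<lceil>x / th\<rceil>"

lemma up_in [simp]: "up x \<in> G" by (simp add: up_def)
lemma up_bounds: "x \<le> up x" "up x - th < x"
proof -
  have "x / th \<le> of_int \<lceil>x / th\<rceil>" "of_int \<lceil>x / th\<rceil> - 1 < x / th" by linarith+
  then have "th * (x / th) \<le> th * of_int \<lceil>x / th\<rceil>" "th * (of_int \<lceil>x / th\<rceil> - 1) < th * (x / th)"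
    using th by (simp_all only: mult_le_cancel_left_pos mult_less_cancel_left_pos)
  then show "x \<le> up x" "up x - th < x" using th by (simp_all add: up_def zg_def algebra_simps)
qed
lemma up_least: "a \<in> G \<Longrightarrow> x \<le> a \<Longrightarrow> up x \<le> a"
  using G_gap[of a "up x"] up_bounds[of x] by force
lemma up_eq: "a \<in> G \<Longrightarrow> a - th < x \<Longrightarrow> x \<le> a \<Longrightarrow> up x = a"
  using up_least[of a x] G_gap[of "up x" a] up_bounds[of x] by force

text \<open>Rounding down so that \<open>rd d < d\<close> strictly: the series over $n \ge -1$ in \<^const>\<open>HSs\<close> is the expectation of
  \<open>V (y - rd d)\<close>, the term $n = -1$ being the atom of the demand at 0.\<close>


definition rd :: "real \<Rightarrow> real" where "rd d = up d - th"

lemma rd_in [simp]: "rd d \<in> G" by (simp add: rd_def G_diff)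
lemma rd_bounds: "rd d < d" "d \<le> rd d + th"
  using up_bounds[of d] by (simp_all add: rd_def)
lemma rd_ge: "0 \<le> d \<Longrightarrow> - th \<le> rd d"
proof -
  assume "0 \<le> d"
  then have "0 \<le> d / th" using th by simp
  then have "0 \<le> \<lceil>d / th\<rceil>" by linarith
  then have "z 0 \<le> z \<lceil>d / th\<rceil>" by simp
  then show ?thesis by (simp add: rd_def up_def zg_def)
qed
lemma rd_z: "rd d = z (\<lceil>d / th\<rceil> - 1)" by (simp add: rd_def up_def z_diff)

section \<open>Convex coercive one-period costs\<close>

lemma gm_nonneg: "t < T \<Longrightarrow> 0 \<le> gm t" using Lip by blast
lemma K_nonneg: "t < T \<Longrightarrow> 0 \<le> K t" using Knonneg by blast
lemma K_dec: "Suc t < T \<Longrightarrow> \<alpha> * K (Suc t) \<le> K t" using Kdec by simp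
lemma C_Lip: "t < T \<Longrightarrow> \<bar>C t x - C t y\<bar> \<le> gm t * \<bar>x - y\<bar>" using Lip by blast
lemma C_Lip': "t < T \<Longrightarrow> \<bar>x - y\<bar> \<le> e \<Longrightarrow> \<bar>C t x - C t y\<bar> \<le> gm t * e"
  using C_Lip[of t x y] gm_nonneg[of t] by (meson mult_left_mono order_trans)
lemma C_convex: "t < T \<Longrightarrow> convex_on UNIV (C t)" using Cconv by blast
lemma C_3: "t < T \<Longrightarrow> u \<le> v \<Longrightarrow> v \<le> w \<Longrightarrow> (w - u) * C t v \<le> (w - v) * C t u + (v - u) * C t w"
  using convex_on_three_points[OF C_convex] by blast
lemma C_cont: "t < T \<Longrightarrow> continuous_on A (C t)"
  using convex_on_continuous[OF open_UNIV C_convex] continuous_on_subset by blast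

lemma C_coercive:
  assumes "t < T" obtains b where "0 < b" "\<And>y. b \<le> \<bar>y\<bar> \<Longrightarrow> c < C t y"
proof -
  have "filterlim (C t) at_top at_infinity" using Cconv assms by blast
  then have "eventually (\<lambda>y. c < C t y) at_infinity"
    using filterlim_at_top_dense by blast
  then obtain b where "\<And>y. b \<le> norm y \<Longrightarrow> c < C t y" unfolding eventually_at_infinity by blast
  then show ?thesis using that[of "max b 1"] by simp
qed

text \<open>The minimizers form a nonempty closed set bounded below, so the infimum defining
  \<open>Cmin\<close> is itself a minimizer.\<close>

lemma Cm_min: assumes t: "t < T" shows "C t (Cm t) \<le> C t x"
proof -
  let ?A = "{y. \<forall>x. C t y \<le> C t x}"
  obtain b where b: "0 < b" "\<And>y. b \<le> \<bar>y\<bar> \<Longrightarrow> C t 0 < C t y" using C_coercive[OF t] by blast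
  have "\<exists>m\<in>{-b..b}. \<forall>y\<in>{-b..b}. C t m \<le> C t y"
    by (rule continuous_attains_inf) (use b C_cont[OF t] in auto)
  then obtain m where m: "m \<in> {-b..b}" "\<And>y. y \<in> {-b..b} \<Longrightarrow> C t m \<le> C t y" by blast
  have "C t m \<le> C t y" for y
    using m(2)[of y] m(2)[of 0] b(1) b(2)[of y] by (cases "y \<in> {-b..b}") force+
  then have ne: "?A \<noteq> {}" by blast
  have bd: "bdd_below ?A"
  proof (rule bdd_belowI[of _ "-b"])
    fix y assume "y \<in> ?A" then show "- b \<le> y" using b(2)[of y] by (force simp: not_less[symmetric])
  qed
  have "?A = (\<Inter>x. {y. C t y \<le> C t x})" by auto
  moreover have "closed {y. C t y \<le> C t x}" for x
    by (intro closed_Collect_le C_cont[OF t] continuous_intros)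
  ultimately have "closed ?A" by auto
  from closed_contains_Inf[OF ne bd this] show ?thesis by (simp add: Cmin_def)
qed

lemma Cm_lt: assumes t: "t < T" and "x < Cm t" shows "C t (Cm t) < C t x"
proof (rule ccontr)
  assume "\<not> ?thesis"
  then have "\<forall>y. C t x \<le> C t y" using Cm_min[OF t] by (meson not_less order_trans)
  moreover obtain b where b: "0 < b" "\<And>y. b \<le> \<bar>y\<bar> \<Longrightarrow> C t 0 < C t y" using C_coercive[OF t] by blast
  have "bdd_below {y. \<forall>x. C t y \<le> C t x}"
  proof (rule bdd_belowI[of _ "-b"])
    fix y assume "y \<in> {y. \<forall>x. C t y \<le> C t x}"
    then show "- b \<le> y" using b(2)[of y] by (force simp: not_less[symmetric])
  qed
  ultimately have "Cm t \<le> x" unfolding Cmin_def by (intro cInf_lower) auto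
  with assms show False by simp
qed

text \<open>Convexity spreads the strict drop towards the least minimizer to every pair on its left;
  this makes the root in \<open>sLast\<close> unique.\<close>

lemma C_strict: assumes t: "t < T" and "x < y" "y \<le> Cm t" shows "C t y < C t x"
proof (cases "y = Cm t")
  case False
  have "(Cm t - x) * C t y \<le> (Cm t - y) * C t x + (y - x) * C t (Cm t)"
    using C_3[OF t, of x y "Cm t"] assms by simp
  also have "(y - x) * C t (Cm t) < (y - x) * C t x"
    using Cm_lt[OF t, of x] assms by (intro mult_strict_left_mono) auto
  finally have "(Cm t - x) * C t y < (Cm t - x) * C t x" by (simp add: algebra_simps)
  then show ?thesis using assms by simp
qed (use Cm_lt assms in auto)

lemma C_anti: "t < T \<Longrightarrow> x \<le> y \<Longrightarrow> y \<le> Cm t \<Longrightarrow> C t y \<le> C t x"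
  using C_strict[of t x y] by (cases "x = y") auto

lemma C_mono: assumes t: "t < T" and "Cm t \<le> x" "x \<le> y" shows "C t x \<le> C t y"
proof (cases "Cm t = y")
  case False
  have "(y - Cm t) * C t x \<le> (y - x) * C t (Cm t) + (x - Cm t) * C t y"
    using C_3[OF t, of "Cm t" x y] assms by simp
  also have "(y - x) * C t (Cm t) \<le> (y - x) * C t y"
    using Cm_min[OF t, of y] assms by (intro mult_left_mono) auto
  finally have "(y - Cm t) * C t x \<le> (y - Cm t) * C t y" by (simp add: algebra_simps)
  then show ?thesis using assms False by simp
qed (use assms in auto)

text \<open>Existence by the intermediate value theorem on an interval reaching far enough left for
  coercivity to exceed the level; uniqueness, which \<open>THE\<close> requires, by strict
  decrease.\<close>

lemma sLast_props:
  shows "sLast M \<le> Cm L" "C L (sLast M) = C L (Cm L) + K L"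
proof -
  obtain b where b: "0 < b" "\<And>y. b \<le> \<bar>y\<bar> \<Longrightarrow> C L (Cm L) + K L < C L y"
    using C_coercive[OF L_less] by blast
  define l where "l = min (- b) (Cm L)"
  have "b \<le> \<bar>l\<bar>" using b(1) unfolding l_def by linarith
  then have "C L (Cm L) + K L \<le> C L l" using b(2)[of l] by simp
  then have "\<exists>x\<ge>l. x \<le> Cm L \<and> C L x = C L (Cm L) + K L"
    by (intro IVT2') (use K_nonneg C_cont in \<open>auto simp: l_def\<close>)
  then obtain x where x: "x \<le> Cm L" "C L x = C L (Cm L) + K L" by blast
  have "sLast M = x" unfolding sLast_def L_def[symmetric]
  proof (rule the_equality)
    fix y assume "y \<le> Cm L \<and> C L y = C L (Cm L) + K L"
    then show "y = x" using x C_strict[OF L_less, of x y] C_strict[OF L_less, of y x] by force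
  qed (use x in auto)
  with x show "sLast M \<le> Cm L" "C L (sLast M) = C L (Cm L) + K L" by auto
qed

section \<open>Search windows for the policy parameters\<close>

abbreviation "zn0 t \<equiv> z (n0 M th t)"

lemma n0_bounds: "zn0 t < Cm t" "Cm t \<le> zn0 t + th"
  using up_bounds[of "Cm t"] by (simp_all add: n0_def z_diff up_def)

lemma z_bounded_above: "z m \<le> b \<Longrightarrow> m \<le> \<lceil>b / th\<rceil>"
  using up_bounds[of b] unfolding up_def using order_trans z_le by blast

lemma z_bounded_below: "b \<le> z m \<Longrightarrow> \<lceil>b / th\<rceil> \<le> m"
  using up_least[of "z m" b] by (simp add: up_def)

text \<open>The defining inequality concerns a single grid point; monotonicity of \<open>C t\<close>
  right of \<open>Cm t\<close> extends it to all real \<open>y\<close> beyond, as required against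
  real order-up-to levels.\<close>

lemma su_props:
  assumes t: "t < T"
  shows "su t \<in> G" "Cm t \<le> su t" "\<And>y. su t \<le> y \<Longrightarrow> C t (zn0 t) + K t < C t y"
proof -
  let ?P = "\<lambda>m. Cm t \<le> z m \<and> C t (z m) > C t (zn0 t) + K t"
  obtain b where b: "0 < b" "\<And>y. b \<le> \<bar>y\<bar> \<Longrightarrow> C t (zn0 t) + K t < C t y" using C_coercive[OF t] by blast
  have "b \<le> up (max b (Cm t))" "Cm t \<le> up (max b (Cm t))"
    using up_bounds[of "max b (Cm t)"] by simp_all
  then have "?P \<lceil>max b (Cm t) / th\<rceil>"
    using b(1) b(2)[of "up (max b (Cm t))"] by (simp add: up_def)
  then have "?P (LEAST m. ?P m)"
    by (rule int_Least(1)) (use z_bounded_below in blast)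
  then have P: "Cm t \<le> su t" "C t (zn0 t) + K t < C t (su t)" by (simp_all add: SU_def)
  show "su t \<in> G" by (simp add: SU_def)
  show "Cm t \<le> su t" by (rule P)
  show "C t (zn0 t) + K t < C t y" if "su t \<le> y" for y
    using P C_mono[OF t P(1) that] by simp
qed

abbreviation "I \<equiv> Ig M th"
abbreviation "J \<equiv> Ibar M th"

lemma J_last: "J L = sLast M" by (simp add: Ibar_def L_def)

lemma J_eq: assumes "Suc t < T" shows "J t = Ibgrid M th t (I t)"
proof -
  have "T - Suc t = Suc (T - 2 - t)" "T - 2 - (T - 2 - t) = t" "T - 1 - Suc t = T - 2 - t" using assms by auto
  then show ?thesis using assms by (simp add: Ibar_def Ig_def Let_def)
qed

text \<open>The margin \<open>th\<close> in the second claim matches the smallest rounded demand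
  \<open>- th\<close>: from a stock of at most \<open>I t\<close> the next stock always lies below
  \<open>J (Suc t)\<close>, hence where an order is placed.\<close>

lemma I_props: "I t \<in> G" "I t + th < J (Suc t)" "I t < Cm t"
proof -
  define m0 where "m0 = \<lceil>min (J (Suc t) - th) (Cm t) / th\<rceil> - 1"
  have "z m0 < min (J (Suc t) - th) (Cm t)"
    using up_bounds[of "min (J (Suc t) - th) (Cm t)"] by (simp add: m0_def z_diff up_def)
  then have "z (GREATEST m. z m < min (J (Suc t) - th) (Cm t)) < min (J (Suc t) - th) (Cm t)"
    by (rule int_Greatest(1)) (rule z_bounded_above, rule less_imp_le)
  then show "I t \<in> G" "I t + th < J (Suc t)" "I t < Cm t"
    by (auto simp: Ig_def Igrid_def)
qed

lemma J_props:
  assumes t: "Suc t < T"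
  shows "J t \<in> G" "J t \<le> I t" "\<And>y. y \<in> G \<Longrightarrow> y < J t \<Longrightarrow> C t (I t) + K t < C t y"
proof -
  have t': "t < T" using t by simp
  let ?P = "\<lambda>m. z m \<le> I t \<and> C t (z m) > C t (I t) + K t"
  let ?m = "GREATEST m. ?P m"
  obtain b where b: "0 < b" "\<And>y. b \<le> \<bar>y\<bar> \<Longrightarrow> C t (I t) + K t < C t y" using C_coercive[OF t'] by blast
  define x where "x = up (min (- b) (I t)) - th"
  have x: "x \<le> I t" "x \<le> - b" using up_bounds[of "min (- b) (I t)"] by (auto simp: x_def)
  have "x = z (\<lceil>min (- b) (I t) / th\<rceil> - 1)" by (simp add: x_def up_def z_diff)
  moreover have "C t (I t) + K t < C t x" using b(2)[of x] x b(1) by simp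
  ultimately have "?P (\<lceil>min (- b) (I t) / th\<rceil> - 1)" using x(1) by simp
  then have P: "?P ?m"
    by (rule int_Greatest(1)) (blast intro: z_bounded_above)
  have J: "J t = z ?m + th" by (simp add: J_eq[OF t] Ibgrid_def)
  show "J t \<in> G" by (simp add: J G_add)
  have "z ?m \<noteq> I t" using P K_nonneg[OF t'] by auto
  then show JI: "J t \<le> I t" using G_gap[of "z ?m" "I t"] P I_props(1) J by simp
  fix y assume "y \<in> G" "y < J t"
  then have "y \<le> z ?m" using G_gap[of "z ?m" y] J by force
  then have "C t (z ?m) \<le> C t y" using C_anti[OF t'] P I_props(3)[of t] by force
  then show "C t (I t) + K t < C t y" using P by simp
qed

section \<open>Expectations under the rounded demand\<close>

lemma dem_prob: "t < T \<Longrightarrow> prob_space (dem M t)" using demand by blast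
lemma dem_sets: "t < T \<Longrightarrow> sets (dem M t) = sets borel" using demand by blast
lemma dem_space: "t < T \<Longrightarrow> space (dem M t) = UNIV" using sets_eq_imp_space_eq[OF dem_sets] by simp
lemma dem_AE: "t < T \<Longrightarrow> AE d in dem M t. 0 \<le> d" using demand by blast
lemma dem_int: "t < T \<Longrightarrow> integrable (dem M t) (\<lambda>d. d)" using demand by blast
lemma dem_meas: "t < T \<Longrightarrow> f \<in> borel_measurable (dem M t) \<longleftrightarrow> f \<in> borel_measurable borel"
  using measurable_cong_sets[OF dem_sets refl] by blast
lemma dem_const: "t < T \<Longrightarrow> integrable (dem M t) (\<lambda>d. c::real)"
  using dem_prob prob_space.finite_measure finite_measure.integrable_const by blast
lemma dem_measure: "t < T \<Longrightarrow> measure (dem M t) (space (dem M t)) = 1"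
  by (rule prob_space.prob_space[OF dem_prob])

lemma cdf_nonneg: "0 \<le> cdf M t x" by (simp add: cdf_def)
lemma cdf_le_1: "t < T \<Longrightarrow> cdf M t x \<le> 1"
  unfolding cdf_def by (rule prob_space.prob_le_1[OF dem_prob])

text \<open>Functions that are constant far to the left take finitely many values at \<open>y - rd d\<close> for \<open>d \<ge> 0\<close>, so
  no measurability or growth condition is needed below.\<close>


definition left_const :: "(real \<Rightarrow> real) \<Rightarrow> bool" where
  "left_const h \<longleftrightarrow> (\<exists>b c. \<forall>y<b. h y = c)"

lemma left_constI: "(\<And>y. y < b \<Longrightarrow> h y = c) \<Longrightarrow> left_const h"
  unfolding left_const_def by blast

lemma left_const_const [simp]: "left_const (\<lambda>y. c)" by (rule left_constI) simp

definition E :: "nat \<Rightarrow> (real \<Rightarrow> real) \<Rightarrow> real \<Rightarrow> real" where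
  "E t h y = (\<integral>d. h (y - rd d) \<partial>dem M t)"

lemma E_integrable:
  assumes t: "t < T" and h: "left_const h"
  shows "integrable (dem M t) (\<lambda>d. h (y - rd d))"
proof -
  obtain b c where c: "\<And>y. y < b \<Longrightarrow> h y = c" using h unfolding left_const_def by blast
  define N where "N = \<lceil>(y - b) / th\<rceil>"
  define B where "B = \<bar>c\<bar> + (\<Sum>m\<in>{-1..N}. \<bar>h (y - z m)\<bar>)"
  have "\<bar>h (y - rd d)\<bar> \<le> B" if "0 \<le> d" for d
  proof (cases "y - rd d < b")
    case True
    then show ?thesis using c by (simp add: B_def sum_nonneg)
  next
    case False
    define m where "m = \<lceil>d / th\<rceil> - 1"
    have m: "rd d = z m" by (simp add: m_def rd_z)
    have "0 \<le> d / th" using that th by simp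
    then have "-1 \<le> m" unfolding m_def by linarith
    moreover have "m \<le> N" using False z_bounded_above[of m "y - b"] m by (simp add: N_def)
    ultimately have "\<bar>h (y - z m)\<bar> \<le> (\<Sum>m\<in>{-1..N}. \<bar>h (y - z m)\<bar>)"
      by (intro member_le_sum) auto
    then show ?thesis by (simp add: B_def m)
  qed
  then have "AE d in dem M t. norm (h (y - rd d)) \<le> B"
    using dem_AE[OF t] by (auto elim!: eventually_mono)
  moreover have "(\<lambda>d. (\<lambda>m d. h (y - z (m - 1))) \<lceil>d / th\<rceil> d) \<in> borel_measurable borel"
    by (rule measurable_compose_countable) auto
  then have "(\<lambda>d. h (y - rd d)) \<in> borel_measurable (dem M t)"
    by (simp add: dem_meas[OF t] rd_z)
  ultimately show ?thesis
    by (rule finite_measure.integrable_const_bound[OF prob_space.finite_measure[OF dem_prob[OF t]]])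
qed

text \<open>Countable additivity over the fibres \<open>A j\<close> of \<open>rd\<close>. Demand is
  almost surely nonnegative, so \<open>j = 0\<close> collects just the atom at 0.\<close>

lemma E_suminf:
  assumes t: "t < T" and h: "left_const h"
  shows "(\<Sum>j. h (y - z (int j - 1)) * fg M th t (int j - 1)) = E t h y"
proof -
  interpret prob_space "dem M t" by (rule dem_prob[OF t])
  define A where "A j = {z (int j - 1) <.. z (int j)}" for j :: nat
  let ?f = "\<lambda>d. h (y - rd d)"
  have A: "A j \<in> sets (dem M t)" for j by (simp add: A_def dem_sets[OF t])
  have rdA: "rd d = z (int j - 1)" if "d \<in> A j" for d j
    using up_eq[of "z (int j)" d] that by (simp add: A_def rd_def z_diff)
  have disj: "A i \<inter> A j = {}" if "i \<noteq> j" for i j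
  proof (rule ccontr)
    assume "A i \<inter> A j \<noteq> {}"
    then obtain d where "d \<in> A i" "d \<in> A j" by blast
    then have "z (int i - 1) = z (int j - 1)" using rdA by metis
    then show False using that z_le[of "int i - 1" "int j - 1"] z_le[of "int j - 1" "int i - 1"] by simp
  qed
  have AU: "d \<in> (\<Union>j. A j)" if "0 \<le> d" for d
  proof -
    have "0 \<le> d / th" using that th by simp
    then have "0 \<le> \<lceil>d / th\<rceil>" by linarith
    then have "d \<in> A (nat \<lceil>d / th\<rceil>)" using up_bounds[of d] by (simp add: A_def up_def z_diff)
    then show ?thesis by blast
  qed
  have int: "integrable (dem M t) ?f" by (rule E_integrable[OF t h])
  have mU: "(\<Union>j. A j) \<in> sets (dem M t)" using A by blast
  have "E t h y = (LINT d:(\<Union>j. A j)|dem M t. ?f d)"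
    unfolding E_def set_lebesgue_integral_def
  proof (rule integral_cong_AE)
    show "AE d in dem M t. ?f d = indicat_real (\<Union>j. A j) d *\<^sub>R ?f d"
      using dem_AE[OF t] by (rule eventually_mono) (use AU in \<open>auto simp: indicator_def\<close>)
  qed (use int mU in auto)
  also have "\<dots> = (\<Sum>j. (LINT d:(A j)|dem M t. ?f d))"
  proof (rule lebesgue_integral_countable_add[OF A disj])
    show "set_integrable (dem M t) (\<Union>j. A j) ?f"
      unfolding set_integrable_def using int mU by (intro integrable_mult_indicator)
  qed
  also have "(\<lambda>j. (LINT d:(A j)|dem M t. ?f d)) = (\<lambda>j. h (y - z (int j - 1)) * fg M th t (int j - 1))"
  proof
    fix j
    have "(LINT d:(A j)|dem M t. ?f d) = (\<integral>d. indicat_real (A j) d * h (y - z (int j - 1)) \<partial>dem M t)"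
      unfolding set_lebesgue_integral_def
      by (intro Bochner_Integration.integral_cong) (auto simp: indicator_def rdA)
    also have "\<dots> = measure (dem M t) (A j) * h (y - z (int j - 1))"
      using A[of j] by (simp add: dem_space[OF t])
    also have "measure (dem M t) (A j) = measure (dem M t) ({..z (int j)} - {..z (int j - 1)})"
      by (rule arg_cong[where f = "measure (dem M t)"]) (auto simp: A_def)
    also have "\<dots> = fg M th t (int j - 1)"
      using finite_measure_Diff[of "{..z (int j)}" "{..z (int j - 1)}"]
      by (simp add: dem_sets[OF t] fg_def cdf_def)
    finally show "(LINT d:(A j)|dem M t. ?f d) = h (y - z (int j - 1)) * fg M th t (int j - 1)" by simp
  qed
  finally show ?thesis by simp
qed

text \<open>One transfer principle for all comparisons: three terms on the left serve the cell
  means, and \<open>f\<close> holds an integrand under the unrounded demand. Instantiations give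
  coefficient 0 to empty slots.\<close>

lemma E_lincomb:
  assumes t: "t < T" and lc: "left_const h1" "left_const h2" "left_const h3" "left_const k1" "left_const k2"
    and f: "integrable (dem M t) f"
    and le: "\<And>d. 0 \<le> d \<Longrightarrow> e * f d + a1 * h1 (x1 - rd d) + a2 * h2 (x2 - rd d) + a3 * h3 (x3 - rd d)
                \<le> c + b1 * k1 (y1 - rd d) + b2 * k2 (y2 - rd d)"
  shows "e * (\<integral>d. f d \<partial>dem M t) + a1 * E t h1 x1 + a2 * E t h2 x2 + a3 * E t h3 x3
                \<le> c + b1 * E t k1 y1 + b2 * E t k2 y2"
proof -
  note [simp] = E_integrable[OF t lc(1)] E_integrable[OF t lc(2)] E_integrable[OF t lc(3)]
    E_integrable[OF t lc(4)] E_integrable[OF t lc(5)] f dem_const[OF t] dem_measure[OF t]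
  have "(\<integral>d. e * f d + a1 * h1 (x1 - rd d) + a2 * h2 (x2 - rd d) + a3 * h3 (x3 - rd d) \<partial>dem M t)
     \<le> (\<integral>d. c + b1 * k1 (y1 - rd d) + b2 * k2 (y2 - rd d) \<partial>dem M t)"
  proof (rule integral_mono_AE)
    show "AE d in dem M t. e * f d + a1 * h1 (x1 - rd d) + a2 * h2 (x2 - rd d) + a3 * h3 (x3 - rd d)
        \<le> c + b1 * k1 (y1 - rd d) + b2 * k2 (y2 - rd d)"
      using dem_AE[OF t] by (rule eventually_mono) (rule le)
  qed simp_all
  then show ?thesis by (simp add: E_def)
qed

lemma E_mono:
  assumes "t < T" "left_const h" "left_const k"
    and "\<And>d. 0 \<le> d \<Longrightarrow> h (x - rd d) \<le> k (y - rd d)"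
  shows "E t h x \<le> E t k y"
  using E_lincomb[of t h h h k k "\<lambda>_. 0" 0 1 x 0 x 0 x 0 1 y 0 y] assms by (simp add: dem_const)

lemma E_const: "t < T \<Longrightarrow> E t (\<lambda>y. c) x = c"
  by (simp add: E_def dem_measure)

lemma E_nonneg: "t < T \<Longrightarrow> (\<And>d. 0 \<le> d \<Longrightarrow> 0 \<le> h (x - rd d)) \<Longrightarrow> 0 \<le> E t h x"
  unfolding E_def by (intro integral_nonneg_AE eventually_mono[OF dem_AE]) auto

text \<open>Rounding lowers a demand by at most \<open>th\<close>, so a rounded demand of at most
  \<open>x\<close> comes from a demand of at most \<open>x + th\<close>; hence the argument of
  \<open>cdf\<close>.\<close>

lemma E_cutoff_le_cdf:
  assumes t: "t < T" and "0 \<le> B" and h: "left_const h"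
    and "\<And>d. 0 \<le> d \<Longrightarrow> d \<le> x + th \<Longrightarrow> h (y - rd d) \<le> B"
    and "\<And>d. x < rd d \<Longrightarrow> h (y - rd d) \<le> 0"
  shows "E t h y \<le> cdf M t (x + th) * B"
proof -
  interpret prob_space "dem M t" by (rule dem_prob[OF t])
  have "h (y - rd d) \<le> indicat_real {..x + th} d * B" if "0 \<le> d" for d
  proof (cases "d \<le> x + th")
    case False
    then show ?thesis using assms(5)[of d] rd_bounds[of d] by simp
  qed (use assms that in simp)
  note le = this
  have "E t h y \<le> (\<integral>d. indicat_real {..x + th} d * B \<partial>dem M t)"
    unfolding E_def
  proof (rule integral_mono_AE)
    show "AE d in dem M t. h (y - rd d) \<le> indicat_real {..x + th} d * B"
      using dem_AE[OF t] by (rule eventually_mono) (rule le)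
  qed (auto intro!: E_integrable[OF t h] simp: dem_sets[OF t] emeasure_eq_measure)
  also have "\<dots> = cdf M t (x + th) * B" by (simp add: cdf_def dem_space[OF t])
  finally show ?thesis .
qed

section \<open>Optimality on the grid\<close>

definition V :: "nat \<Rightarrow> real \<Rightarrow> real" where
  "V t y = (if y < s t then H t (S t) + K t else H t y)"

lemma V_left_const [simp]: "left_const (V t)"
  by (rule left_constI[of "s t" _ "H t (S t) + K t"]) (simp add: V_def)

lemma index_arith:
  assumes "Suc t < T"
  shows "T - Suc t = Suc (T - 2 - t)" "T - 2 - (T - 2 - t) = t" "T - 1 - Suc t = T - 2 - t"
    "T - 1 - t = Suc (T - 2 - t)"
  using assms by auto

lemma last_eq: "H L = C L" "S L = Cm L" "s L = sLast M"
  by (simp_all add: Hf_def Sf_def sf_def L_def)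

lemma H_eq: assumes t: "Suc t < T" shows "H t y = C t y + \<alpha> * E t (V (Suc t)) y"
proof -
  have "H t y = C t y + \<alpha> * (\<Sum>j. V (Suc t) (y - z (int j - 1)) * fg M th t (int j - 1))"
    unfolding V_def Hf_def Sf_def sf_def index_arith(3)[OF t] index_arith(4)[OF t] HSs.simps Let_def
      index_arith(2)[OF t] fst_conv snd_conv ..
  then show ?thesis using E_suminf[of t "V (Suc t)" y] t by simp
qed

lemma S_eq: assumes t: "Suc t < T"
  shows "S t = z (GREATEST m. I t \<le> z m \<and> z m \<le> su t \<and>
                 (\<forall>n. I t \<le> z n \<and> z n \<le> su t \<longrightarrow> H t (z m) \<le> H t (z n)))"
  unfolding Hf_def Sf_def index_arith(4)[OF t] HSs.simps Let_def
      index_arith(2)[OF t] fst_conv snd_conv ..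

lemma s_eq: assumes t: "Suc t < T"
  shows "s t = (if K t = 0 then S t
                else z (LEAST m. J t \<le> z m \<and> z m \<le> S t \<and> H t (z m) \<le> H t (S t) + K t))"
  unfolding Hf_def Sf_def sf_def index_arith(4)[OF t] HSs.simps Let_def
      index_arith(2)[OF t] fst_conv snd_conv ..

lemma S_props:
  assumes t: "Suc t < T"
  shows "S t \<in> G" "I t \<le> S t" "S t \<le> su t"
    "\<And>y. y \<in> G \<Longrightarrow> I t \<le> y \<Longrightarrow> y \<le> su t \<Longrightarrow> H t (S t) \<le> H t y"
proof -
  have t': "t < T" using t by simp
  let ?A = "{m. I t \<le> z m \<and> z m \<le> su t}"
  let ?P = "\<lambda>m. I t \<le> z m \<and> z m \<le> su t \<and>
                 (\<forall>n. I t \<le> z n \<and> z n \<le> su t \<longrightarrow> H t (z m) \<le> H t (z n))"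
  obtain i where i: "I t = z i" using I_props(1)[of t] by (auto simp: G_def)
  have "I t \<le> su t" using I_props(3)[of t] su_props(2)[OF t'] by simp
  then have ne: "?A \<noteq> {}" using i by auto
  have "?A \<subseteq> {\<lceil>I t / th\<rceil>..\<lceil>su t / th\<rceil>}" using z_bounded_above z_bounded_below by auto
  then have fin: "finite ?A" by (rule finite_subset) simp
  \<comment> \<open>A minimizer over the finite window shows that the predicate under
    \<open>GREATEST\<close> is inhabited.\<close>
  let ?m = "arg_min_on (\<lambda>m. H t (z m)) ?A"
  have "?P ?m" using arg_min_if_finite[OF fin ne, of "\<lambda>m. H t (z m)"] by (auto simp: not_less)
  then have "?P (GREATEST m. ?P m)"
    by (rule int_Greatest(1)) (blast intro: z_bounded_above)
  then show "S t \<in> G" "I t \<le> S t" "S t \<le> su t"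
    "\<And>y. y \<in> G \<Longrightarrow> I t \<le> y \<Longrightarrow> y \<le> su t \<Longrightarrow> H t (S t) \<le> H t y"
    by (auto simp: S_eq[OF t] G_def)
qed

lemma s_props:
  assumes t: "Suc t < T"
  shows "s t \<in> G" "J t \<le> s t" "s t \<le> S t" "H t (s t) \<le> H t (S t) + K t"
    "\<And>y. y \<in> G \<Longrightarrow> J t \<le> y \<Longrightarrow> y < s t \<Longrightarrow> K t \<noteq> 0 \<Longrightarrow> H t (S t) + K t \<le> H t y"
proof -
  have t': "t < T" using t by simp
  let ?P = "\<lambda>m. J t \<le> z m \<and> z m \<le> S t \<and> H t (z m) \<le> H t (S t) + K t"
  have JS: "J t \<le> S t" using J_props(2)[OF t] S_props(2)[OF t] by simp
  obtain i where i: "S t = z i" using S_props(1)[OF t] by (auto simp: G_def)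
  have ex: "?P i" using JS i K_nonneg[OF t'] by simp
  have bd: "\<lceil>J t / th\<rceil> \<le> m" if "?P m" for m using that z_bounded_below by blast
  have P: "?P (LEAST m. ?P m)" "\<And>n. ?P n \<Longrightarrow> (LEAST m. ?P m) \<le> n"
    using int_Least[of ?P, OF ex bd] by blast+
  show "s t \<in> G" "J t \<le> s t" "s t \<le> S t" "H t (s t) \<le> H t (S t) + K t"
    using P(1) JS S_props(1)[OF t] K_nonneg[OF t'] by (auto simp: s_eq[OF t])
  fix y assume y: "y \<in> G" "J t \<le> y" "y < s t" "K t \<noteq> 0"
  then obtain n where n: "y = z n" by (auto simp: G_def)
  show "H t (S t) + K t \<le> H t y"
  proof (rule ccontr)
    assume "\<not> ?thesis"
    moreover have "y \<le> S t" using y \<open>s t \<le> S t\<close> by simp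
    ultimately have "?P n" using y n by simp
    then have "s t \<le> y" using P(2)[of n] y n by (simp add: s_eq[OF t])
    then show False using y by simp
  qed
qed

lemma s_le_S: "t < T \<Longrightarrow> s t \<le> S t"
proof (cases "Suc t < T")
  case False
  assume "t < T"
  with False have "t = L" by (simp add: eq_L)
  then show ?thesis using sLast_props(1) last_eq by simp
qed (use s_props in blast)

lemma J_le_s: "t < T \<Longrightarrow> J t \<le> s t"
proof (cases "Suc t < T")
  case False
  assume "t < T"
  with False have "t = L" by (simp add: eq_L)
  then show ?thesis using J_last last_eq by simp
qed (use s_props in blast)

text \<open>The next stock \<open>y - rd d\<close> never exceeds \<open>y + th\<close>, so every
  demand leads to the constant part of \<open>V (Suc t)\<close>.\<close>

lemma E_V_const:
  assumes t: "Suc t < T" and y: "y + th < s (Suc t)"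
  shows "E t (V (Suc t)) y = H (Suc t) (S (Suc t)) + K (Suc t)"
proof -
  have t': "t < T" using t by simp
  let ?c = "H (Suc t) (S (Suc t)) + K (Suc t)"
  have V: "V (Suc t) (y - rd d) = ?c" if "0 \<le> d" for d
    using y rd_ge[OF that] by (simp add: V_def)
  have "E t (V (Suc t)) y \<le> E t (\<lambda>_. ?c) y" by (rule E_mono[OF t']) (simp_all add: V)
  moreover have "E t (\<lambda>_. ?c) y \<le> E t (V (Suc t)) y" by (rule E_mono[OF t']) (simp_all add: V)
  ultimately show ?thesis by (simp add: E_const[OF t'])
qed

lemma I_le_zn0: "I t \<le> zn0 t"
proof (rule ccontr)
  assume "\<not> ?thesis"
  then have "zn0 t + th \<le> I t" by (intro G_gap I_props) auto
  then show False using n0_bounds(2)[of t] I_props(3)[of t] by simp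
qed

text \<open>The last order-up-to data \<open>s L\<close>, \<open>S L\<close> need not lie on the grid.\<close>


definition phase :: "nat \<Rightarrow> real set" where
  "phase t = (if Suc t < T then G else UNIV)"

lemma G_phase: "G \<subseteq> phase t" by (simp add: phase_def)

lemma V_policy: "sS_policy (K t) (phase t) (H t) (s t) (S t) \<Longrightarrow>
    V t = sS_policy.V (K t) (H t) (s t) (S t)"
  by (rule ext) (simp add: V_def sS_policy.V_def)

text \<open>Averaging over grid shifts preserves K-convexity, and discounting brings its constant
  from \<open>K (Suc t)\<close> down to at most \<open>K t\<close>. The finite windows lose nothing:
  left of \<open>I t\<close> the expected future cost is constant and \<open>C t\<close> decides;
  right of \<open>su t\<close> the future gain is at most \<open>\<alpha> * K (Suc t)\<close>, less
  than the excess of \<open>C t\<close> over its value at \<open>zn0 t\<close>.\<close>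

lemma sS_optimal: "t < T \<Longrightarrow> sS_policy (K t) (phase t) (H t) (s t) (S t)"
proof (induction t rule: horizon_induct)
  case last
  let ?t = L
  note t = L_less
  have *: "C ?t (Cm ?t) + K ?t \<le> C ?t y" if "y < sLast M" for y
    using C_anti[OF t, of y "sLast M"] sLast_props that by simp
  show ?case
    unfolding last_eq phase_def
    by unfold_locales
      (use t K_nonneg[OF t] convex_imp_K_convex_on[OF C_convex[OF t] K_nonneg[OF t]] sLast_props Cm_min[OF t] * in auto)
next
  case (step t)
  then have t: "Suc t < T" and t': "t < T" by simp_all
  interpret nxt: sS_policy "K (Suc t)" "phase (Suc t)" "H (Suc t)" "s (Suc t)" "S (Suc t)" by (rule step)
  let ?V = "V (Suc t)"
  note V = V_policy[OF step(2)]
  have Vc: "K_convex_on (K (Suc t)) G ?V"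
    unfolding V by (rule K_convex_on_subset[OF nxt.V_K_convex G_phase])
  have VK: "?V a \<le> K (Suc t) + ?V b" if "a \<in> G" "b \<in> G" "a \<le> b" for a b
    unfolding V using nxt.V_le_K_plus[of a b] that G_phase by blast
  have Kd: "\<alpha> * K (Suc t) \<le> K t" by (rule K_dec[OF t])
  have EK: "E t ?V a \<le> K (Suc t) + E t ?V b" if "a \<in> G" "b \<in> G" "a \<le> b" for a b
    using E_lincomb[OF t' V_left_const V_left_const V_left_const V_left_const V_left_const dem_const[OF t'],
        of 0 0 1 "Suc t" a 0 "Suc t" a 0 "Suc t" a "K (Suc t)" 1 "Suc t" b 0 "Suc t" b] VK that
    by (simp add: G_diff)
  have Hconv: "K_convex_on (K t) G (H t)"
    unfolding K_convex_on_def
  proof (intro ballI impI)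
    fix u v w assume G: "u \<in> G" "v \<in> G" "w \<in> G" and uv: "u < v" "v \<le> w"
    define r where "r = (w - v) / (v - u)"
    have "(1 + r) * ?V (v - rd d) + (- r) * ?V (u - rd d) \<le> K (Suc t) + ?V (w - rd d)" for d
    proof -
      \<comment> \<open>\<open>r\<close> is invariant under the shift by \<open>rd d\<close>, so the
        inequalities for all demands share their coefficients and can be integrated.\<close>
      have "r = ((w - rd d) - (v - rd d)) / ((v - rd d) - (u - rd d))" by (simp add: r_def)
      then show ?thesis
        using K_convex_onD[OF Vc, of "u - rd d" "v - rd d" "w - rd d"] G uv
        by (simp add: G_diff algebra_simps)
    qed
    then have "(1 + r) * E t ?V v + (- r) * E t ?V u \<le> K (Suc t) + E t ?V w"
      using E_lincomb[OF t' V_left_const V_left_const V_left_const V_left_const V_left_const dem_const[OF t'],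
        of 0 0 "1 + r" "Suc t" v "- r" "Suc t" u 0 "Suc t" v "K (Suc t)" 1 "Suc t" w 0 "Suc t" w]
      by simp
    then have "\<alpha> * ((1 + r) * E t ?V v + (- r) * E t ?V u) \<le> \<alpha> * (K (Suc t) + E t ?V w)"
      using alpha by (intro mult_left_mono) auto
    moreover have "C t v + r * (C t v - C t u) \<le> C t w"
      using K_convex_onD[OF convex_imp_K_convex_on[OF C_convex[OF t'], of 0 UNIV], of u v w] uv
      by (simp add: r_def)
    ultimately show "H t v + (w - v) / (v - u) * (H t v - H t u) \<le> K t + H t w"
      unfolding r_def[symmetric] H_eq[OF t] using Kd by (simp add: algebra_simps)
  qed
  have far: "E t ?V y = E t ?V (I t)" if "y \<le> I t" for y
    using E_V_const[OF t, of y] E_V_const[OF t, of "I t"] I_props(2)[of t] J_le_s[OF t] that by simp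
  have ISmin: "H t (S t) \<le> H t (I t)"
    using S_props(4)[OF t I_props(1)] I_props(3)[of t] su_props(2)[OF t'] by simp
  have min: "H t (S t) \<le> H t y" if "y \<in> G" for y
  proof -
    consider "y < I t" | "I t \<le> y" "y \<le> su t" | "su t < y" by linarith
    then show ?thesis
    proof cases
      case 1
      then have "C t (I t) \<le> C t y" using C_anti[OF t', of y "I t"] I_props(3)[of t] by simp
      then have "H t (I t) \<le> H t y" using far[of y] 1 by (simp add: H_eq[OF t])
      with ISmin show ?thesis by simp
    next
      case 2
      then show ?thesis using S_props(4)[OF t that] by simp
    next
      case 3
      have z0: "zn0 t \<le> su t" using n0_bounds(1)[of t] su_props(2)[OF t'] by simp
      have "\<alpha> * E t ?V (zn0 t) \<le> \<alpha> * (K (Suc t) + E t ?V y)"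
        using EK[OF z_in that, of "n0 M th t"] 3 z0 alpha by (intro mult_left_mono) auto
      moreover have "C t (zn0 t) + K t < C t y" using su_props(3)[OF t', of y] 3 by simp
      moreover have "H t (S t) \<le> H t (zn0 t)" using S_props(4)[OF t z_in I_le_zn0 z0] .
      ultimately show ?thesis using Kd by (simp add: H_eq[OF t] algebra_simps)
    qed
  qed
  have below: "H t (S t) + K t \<le> H t y" if "y \<in> G" "y < s t" for y
  proof (cases "J t \<le> y \<or> K t = 0")
    case True
    then show ?thesis using s_props(5)[OF t that(1)] that min[OF that(1)] by (cases "K t = 0") auto
  next
    case False
    then have "C t (I t) + K t < C t y" "y \<le> I t"
      using J_props(2,3)[OF t] that by fastforce+
    then show ?thesis using far[of y] ISmin by (simp add: H_eq[OF t])
  qed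
  have "phase t = G" using t by (simp add: phase_def)
  then show ?case
    by (intro sS_policy.intro)
      (use K_nonneg[OF t'] Hconv s_props[OF t] S_props[OF t] min below in auto)
qed

lemma H_min: "t < T \<Longrightarrow> a \<in> G \<Longrightarrow> H t (S t) \<le> H t a"
  using sS_policy.min[OF sS_optimal] G_phase by blast

lemma H_below: "t < T \<Longrightarrow> a \<in> G \<Longrightarrow> a < s t \<Longrightarrow> H t (S t) + K t \<le> H t a"
  using sS_policy.below[OF sS_optimal] G_phase by blast

lemma H_at: "t < T \<Longrightarrow> H t (s t) \<le> H t (S t) + K t"
  using sS_policy.at[OF sS_optimal] .

lemma H_no_order: "t < T \<Longrightarrow> a \<in> G \<Longrightarrow> b \<in> G \<Longrightarrow> s t \<le> a \<Longrightarrow> a \<le> b \<Longrightarrow> H t a \<le> K t + H t b"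
  using sS_policy.no_order[OF sS_optimal] G_phase by blast

section \<open>Oscillation on grid cells\<close>

text \<open>The parameter \<open>e\<close> is 0 for $\varphi_t$ and \<open>th\<close> for $\bar\varphi_t$.\<close>


definition ph :: "real \<Rightarrow> nat \<Rightarrow> real \<Rightarrow> real \<Rightarrow> real" where
  "ph e t x = phr M th gm e (T - 1 - t) x"

lemma ph_zero: assumes "t < T" "y < s t" shows "ph e t x y = 0"
proof (cases "Suc t < T")
  case True
  show ?thesis
    unfolding ph_def index_arith(4)[OF True] phr.simps index_arith(2)[OF True] Let_def
    using assms by simp
next
  case False
  with assms have "t = L" by (simp add: eq_L)
  then show ?thesis using assms by (simp add: ph_def L_def)
qed

lemma ph_left_const: "t < T \<Longrightarrow> left_const (ph e t x)"
  by (rule left_constI[of "s t" _ 0]) (rule ph_zero)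

text \<open>The finite sum is the full series: \<open>ph\<close> vanishes below
  \<open>s (Suc t)\<close>, which removes all indices beyond the floor. For
  \<open>y < s (Suc t) - th\<close> the index range is empty, so the two branches of
  \<open>psiof\<close> agree.\<close>

lemma psig_eq:
  assumes t: "Suc t < T"
  shows "psig M th gm e t x y = gm t * x + \<alpha> * E t (ph e (Suc t) x) y"
proof -
  define N where "N = \<lfloor>(y - s (Suc t)) / th\<rfloor>"
  let ?g = "\<lambda>m. ph e (Suc t) x (y - z m) * fg M th t m"
  have zero: "?g m = 0" if "N < m" for m
  proof -
    have "(y - s (Suc t)) / th < of_int m" using that unfolding N_def by linarith
    then have "y - z m < s (Suc t)" using th by (simp add: zg_def field_simps)
    then show ?thesis using ph_zero t by simp
  qed
  have "E t (ph e (Suc t) x) y = (\<Sum>j. ?g (int j - 1))"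
    using E_suminf[of t "ph e (Suc t) x" y] ph_left_const[OF t] t by simp
  also have "\<dots> = (\<Sum>j<nat (N + 2). ?g (int j - 1))"
  proof (rule suminf_finite)
    fix j assume "j \<notin> {..<nat (N + 2)}"
    then show "?g (int j - 1) = 0" by (intro zero) auto
  qed simp
  also have "\<dots> = (\<Sum>m\<in>{-1..N}. ?g m)"
    by (rule sum.reindex_bij_witness[of _ "\<lambda>m. nat (m + 1)" "\<lambda>j. int j - 1"]) auto
  finally have E: "E t (ph e (Suc t) x) y = (\<Sum>m\<in>{-1..N}. ?g m)" .
  have "N < -1" if "y < s (Suc t) - th"
  proof -
    have "(y - s (Suc t)) / th < -1" using that th by (simp add: field_simps)
    then show ?thesis unfolding N_def by linarith
  qed
  then have "(\<Sum>m\<in>{-1..N}. ?g m) = 0" if "y < s (Suc t) - th" using that by simp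
  moreover have ne: "t \<noteq> T - 1" using t by auto
  moreover have phr: "phr M th gm e (T - 2 - t) = ph e (Suc t)"
    by (rule ext) (simp only: ph_def index_arith(3)[OF t])
  ultimately show ?thesis
    unfolding psig_def if_not_P[OF ne] phr psiof_def N_def[symmetric] E by simp
qed

lemma psig_last: "psig M th gm e L x y = gm L * x"
  by (simp add: psig_def L_def)

lemma ph_last: "ph e L x y = (if y < s L then 0 else gm L * x)"
  by (simp add: ph_def L_def)

lemma ph_eq:
  assumes t: "Suc t < T"
  shows "ph e t x y = (if y < s t then 0
      else if y - x < s t then psig M th gm e t (y - s t + e) y else psig M th gm e t x y)"
proof -
  have "t \<noteq> T - 1" using t by auto
  then show ?thesis
    unfolding ph_def index_arith(4)[OF t] phr.simps index_arith(2)[OF t] Let_def psig_def by simp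
qed

lemma psig_0: "t < T \<Longrightarrow> psig M th gm 0 t 0 y = 0 \<and> ph 0 t 0 y = 0"
proof (induction t arbitrary: y rule: horizon_induct)
  case last
  show ?case by (simp add: psig_last ph_last)
next
  case (step t)
  then have "ph 0 (Suc t) 0 = (\<lambda>_. 0)" by auto
  then have "psig M th gm 0 t 0 y = 0"
    using step(1) by (simp add: psig_eq E_def)
  then show ?case using step(1) by (simp add: ph_eq)
qed

definition P :: "nat \<Rightarrow> real \<Rightarrow> real" where "P t = psi M th gm t th"
definition Pb :: "nat \<Rightarrow> real \<Rightarrow> real" where "Pb t = psibar M th gm t th"
definition f :: "nat \<Rightarrow> real \<Rightarrow> real" where "f t = ph 0 t th"
definition fb :: "nat \<Rightarrow> real \<Rightarrow> real" where "fb t = ph th t th"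

lemma f_left_const: "t < T \<Longrightarrow> left_const (f t)" and fb_left_const: "t < T \<Longrightarrow> left_const (fb t)"
  by (simp_all add: f_def fb_def ph_left_const)

lemma P_eq: "Suc t < T \<Longrightarrow> P t y = gm t * th + \<alpha> * E t (f (Suc t)) y"
  and Pb_eq: "Suc t < T \<Longrightarrow> Pb t y = gm t * th + \<alpha> * E t (fb (Suc t)) y"
  by (simp_all add: P_def Pb_def f_def fb_def psi_def psibar_def psig_eq)

lemma P_last: "P L y = gm L * th" and Pb_last: "Pb L y = gm L * th"
  by (simp_all add: P_def Pb_def psi_def psibar_def psig_last)

text \<open>On the grid the middle branch of \<open>ph\<close> occurs only at
  \<open>y = s t\<close>; there the offset \<open>e = th\<close> makes its first argument
  \<open>th\<close>, and it merges with the last branch.\<close>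

lemma fb_eq:
  assumes t: "t < T" and y: "y \<in> G"
  shows "fb t y = (if y < s t then 0 else Pb t y)"
proof (cases "Suc t < T")
  case True
  have "y = s t" if "s t \<le> y" "y - th < s t"
    using that G_gap[OF s_props(1)[OF True] y] by force
  then show ?thesis using True by (auto simp: fb_def ph_eq Pb_def psibar_def)
next
  case False
  with t have "t = L" by (simp add: eq_L)
  then show ?thesis by (simp add: fb_def ph_last Pb_last)
qed

text \<open>With offset 0 the middle branch at \<open>y = s t\<close> has first argument 0 and
  vanishes. Before the last period the cutoffs of \<open>f\<close> and \<open>fb\<close> thus differ
  exactly in the point \<open>s t\<close>.\<close>

lemma f_eq:
  assumes t: "Suc t < T" and y: "y \<in> G"
  shows "f t y = (if y \<le> s t then 0 else P t y)"
proof -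
  have "\<not> y - th < s t" if "s t < y"
    using that G_gap[OF s_props(1)[OF t] y] by simp
  then show ?thesis using psig_0[of t] t th by (auto simp: f_def ph_eq P_def psi_def)
qed

lemma f_last: "f L y = (if y < s L then 0 else gm L * th)"
  by (simp add: f_def ph_last)

lemma E_diff_le:
  assumes "t < T" "left_const h" "left_const k"
    and "\<And>d. 0 \<le> d \<Longrightarrow> h (a - rd d) - h (b - rd d) \<le> k (c - rd d)"
  shows "E t h a - E t h b \<le> E t k c"
  using E_lincomb[of t h h h k k "\<lambda>_. 0" 0 1 a "-1" b 0 a 0 1 c 0 c] assms by (simp add: dem_const)

lemma alpha_mult_mono: "a \<le> b \<Longrightarrow> \<alpha> * a \<le> \<alpha> * b"
  using alpha by (intro mult_left_mono) auto

lemma f_P_props: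
  assumes "t < T" "a \<in> G" "b \<in> G" "a \<le> b"
  shows "gm t * th \<le> P t a \<and> P t a \<le> P t b \<and> P t a \<le> Pb t a \<and> Pb t a \<le> Pb t b \<and>
    0 \<le> f t a \<and> f t a \<le> f t b \<and> f t a \<le> fb t a \<and> fb t a \<le> fb t b"
  using assms
proof (induction t arbitrary: a b rule: horizon_induct)
  case last
  note t = L_less
  have "0 \<le> gm L * th" using gm_nonneg[OF t] th by simp
  then show ?case using last by (auto simp: P_last Pb_last f_last fb_eq[OF t])
next
  case (step t)
  then have t: "Suc t < T" and t': "t < T" by simp_all
  note IH = step(2)
  note lc = f_left_const[OF t] fb_left_const[OF t]
  have 1: "0 \<le> E t (f (Suc t)) x" if "x \<in> G" for x
    by (rule E_nonneg[OF t']) (use IH[OF G_diff[OF that rd_in] G_diff[OF that rd_in] order_refl] in auto)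
  have 2: "E t (f (Suc t)) a \<le> E t (f (Suc t)) b" "E t (fb (Suc t)) a \<le> E t (fb (Suc t)) b"
    by (rule E_mono[OF t' lc(1,1)], use IH[of "a - rd _" "b - rd _"] step(3-) G_diff in auto)
       (rule E_mono[OF t' lc(2,2)], use IH[of "a - rd _" "b - rd _"] step(3-) G_diff in auto)
  have 3: "E t (f (Suc t)) x \<le> E t (fb (Suc t)) x" if "x \<in> G" for x
    by (rule E_mono[OF t' lc]) (use IH[OF G_diff[OF that rd_in] G_diff[OF that rd_in] order_refl] in auto)
  have g: "0 \<le> gm t * th" using gm_nonneg[OF t'] th by simp
  note P = P_eq[OF t] Pb_eq[OF t]
  have p: "gm t * th \<le> P t a" "P t a \<le> P t b" "P t a \<le> Pb t a" "Pb t a \<le> Pb t b" "gm t * th \<le> P t b"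
    using alpha_mult_mono[OF 1[OF step(3)]] alpha_mult_mono[OF 1[OF step(4)]] alpha_mult_mono[OF 2(1)] alpha_mult_mono[OF 2(2)]
      alpha_mult_mono[OF 3[OF step(3)]] by (simp_all add: P)
  show ?case using p g step(3-) by (auto simp: f_eq[OF t] fb_eq[OF t'])
qed

lemma P_mono: "t < T \<Longrightarrow> a \<in> G \<Longrightarrow> b \<in> G \<Longrightarrow> a \<le> b \<Longrightarrow> P t a \<le> P t b"
  and Pb_mono: "t < T \<Longrightarrow> a \<in> G \<Longrightarrow> b \<in> G \<Longrightarrow> a \<le> b \<Longrightarrow> Pb t a \<le> Pb t b"
  and fb_mono: "t < T \<Longrightarrow> a \<in> G \<Longrightarrow> b \<in> G \<Longrightarrow> a \<le> b \<Longrightarrow> fb t a \<le> fb t b"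
  using f_P_props by blast+

lemma P_le_Pb: "t < T \<Longrightarrow> a \<in> G \<Longrightarrow> P t a \<le> Pb t a"
  and P_ge: "t < T \<Longrightarrow> a \<in> G \<Longrightarrow> gm t * th \<le> P t a"
  and f_nonneg: "t < T \<Longrightarrow> a \<in> G \<Longrightarrow> 0 \<le> f t a"
  and f_le_fb: "t < T \<Longrightarrow> a \<in> G \<Longrightarrow> f t a \<le> fb t a"
  using f_P_props[of t a a] by simp_all

lemma Pb_nonneg: "t < T \<Longrightarrow> a \<in> G \<Longrightarrow> 0 \<le> Pb t a"
  using P_ge[of t a] P_le_Pb[of t a] gm_nonneg[of t] th by (smt (verit) mult_nonneg_nonneg)

text \<open>The exact root \<open>sLast M\<close> makes \<open>V L\<close> continuous: it is
  \<open>C L\<close> frozen left of \<open>s L\<close>, hence Lipschitz. Only earlier periods can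
  have a jump at the threshold.\<close>

lemma V_last: "V L y = C L (max y (s L))"
  by (simp only: V_def last_eq) (auto simp: max_def sLast_props(2))

lemma V_last_Lip: "\<bar>V L a - V L b\<bar> \<le> gm L * \<bar>a - b\<bar>"
  unfolding V_last by (rule C_Lip') (use T3 in auto)

lemma cell_bound:
  assumes "t < T" "c \<in> G" "c - th \<le> a" "a \<le> c" "c - th \<le> b" "b \<le> c"
  shows "H t a - H t b \<le> Pb t c \<and> V t a - V t b \<le> fb t c"
  using assms
proof (induction t arbitrary: a b c rule: horizon_induct)
  case last
  note t = L_less
  have ab: "\<bar>a - b\<bar> \<le> th" using last by auto
  have "V L a - V L b \<le> gm L * th"
    using V_last_Lip[of a b] mult_left_mono[OF ab gm_nonneg[OF t]] by linarith
  then have "V L a - V L b \<le> fb L c"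
    using last by (auto simp: fb_eq[OF t] Pb_last V_last max_def)
  moreover have "H L a - H L b \<le> Pb L c"
    using C_Lip'[OF t ab] by (simp only: last_eq Pb_last)
  ultimately show ?case by simp
next
  case (step t)
  then have t: "Suc t < T" and t': "t < T" by simp_all
  have HH: "H t a - H t b \<le> Pb t c" if "c - th \<le> a" "a \<le> c" "c - th \<le> b" "b \<le> c" for a b
  proof -
    have ab: "\<bar>a - b\<bar> \<le> th" using that by auto
    have "E t (V (Suc t)) a - E t (V (Suc t)) b \<le> E t (fb (Suc t)) c"
      by (rule E_diff_le[OF t' V_left_const fb_left_const[OF t]])
         (use step that in \<open>auto simp: G_diff\<close>)
    from alpha_mult_mono[OF this] C_Lip'[OF t' ab] show ?thesis
      by (simp add: H_eq[OF t] Pb_eq[OF t] algebra_simps)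
  qed
  consider "c < s t" | "s t = c" | "s t \<le> c - th"
    using G_gap[OF s_props(1)[OF t] step(3)] by fastforce
  then have "V t a - V t b \<le> fb t c"
  proof cases
    case 1
    then show ?thesis using step by (simp add: V_def fb_eq)
  next
    case 2
    \<comment> \<open>The jump at \<open>s t = c\<close> is controlled by the cell itself: the
      constant value on its left is at most \<open>H t (c - th)\<close>, which lies within
      \<open>Pb t c\<close> of \<open>H t c\<close>.\<close>
    then have "H t (S t) + K t \<le> H t (c - th)" using step th by (intro H_below[OF t']) (auto simp: G_diff)
    with 2 show ?thesis using step HH[of "c - th" c] HH[of c c] th H_at[OF t']
      by (auto simp: V_def fb_eq not_less le_antisym)
  next
    case 3
    then show ?thesis using step HH[of a b] th by (auto simp: V_def fb_eq)
  qed
  then show ?case using HH[of a b] step by simp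
qed

text \<open>Twice the deviation from the mean of the ends costs one \<open>Pb\<close>. Two uses, at
  the start and at the target of an order, therefore cost one \<open>Pb\<close> together instead of
  two, which is what \<open>eta\<close> provides.\<close>

lemma cell_midpoint_bound:
  assumes "t < T" "c \<in> G" "c - th \<le> x" "x \<le> c"
  shows "\<bar>2 * H t x - H t (c - th) - H t c\<bar> \<le> Pb t c \<and> \<bar>2 * V t x - V t (c - th) - V t c\<bar> \<le> fb t c"
  using assms
proof (induction t arbitrary: x c rule: horizon_induct)
  case last
  note t = L_less
  have C: "\<bar>2 * C L x - C L y - C L w\<bar> \<le> gm L * th"
    if "y \<le> x" "x \<le> w" "w - y \<le> th" for x y w
  proof -
    have "gm L * (w - y) \<le> gm L * th"
      using that gm_nonneg[OF t] by (intro mult_left_mono) auto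
    then show ?thesis
      using C_Lip[OF t, of x y] C_Lip[OF t, of x w] that by (simp add: algebra_simps)
  qed
  have "\<bar>2 * H L x - H L (c - th) - H L c\<bar> \<le> Pb L c"
    using C[of "c - th" x c] last by (simp only: last_eq Pb_last)
  moreover have "\<bar>2 * V L x - V L (c - th) - V L c\<bar> \<le> gm L * th"
    unfolding V_last by (rule C) (use last th in auto)
  then have "\<bar>2 * V L x - V L (c - th) - V L c\<bar> \<le> fb L c"
    using last th by (auto simp: fb_eq[OF t] Pb_last V_last max_def)
  ultimately show ?case by simp
next
  case (step t)
  then have t: "Suc t < T" and t': "t < T" by simp_all
  have c: "\<bar>2 * C t x - C t (c - th) - C t c\<bar> \<le> gm t * th"
    using C_Lip[OF t', of x "c - th"] C_Lip[OF t', of x c] step by (simp add: algebra_simps)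
  let ?V = "V (Suc t)" and ?f = "fb (Suc t)"
  have IH: "\<bar>2 * ?V (x - rd d) - ?V (c - th - rd d) - ?V (c - rd d)\<bar> \<le> ?f (c - rd d)" for d
    using step(2)[of "c - rd d" "x - rd d"] step by (simp add: G_diff algebra_simps)
  have IH1: "2 * ?V (x - rd d) - ?V (c - th - rd d) - ?V (c - rd d) \<le> ?f (c - rd d)"
    and IH2: "?V (c - th - rd d) - 2 * ?V (x - rd d) + ?V (c - rd d) \<le> ?f (c - rd d)" for d
    using IH[of d] by linarith+
  note lin = E_lincomb[OF t' V_left_const V_left_const V_left_const fb_left_const[OF t] fb_left_const[OF t] dem_const[OF t']]
  have "2 * E t ?V x - E t ?V (c - th) - E t ?V c \<le> E t ?f c"
    using lin[of 0 0 2 "Suc t" x "-1" "Suc t" "c - th" "-1" "Suc t" c 0 1 c 0 c] IH1 by simp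
  moreover have "E t ?V (c - th) - 2 * E t ?V x + E t ?V c \<le> E t ?f c"
    using lin[of 0 0 1 "Suc t" "c - th" "-2" "Suc t" x 1 "Suc t" c 0 1 c 0 c] IH2 by simp
  ultimately have "\<bar>2 * E t ?V x - E t ?V (c - th) - E t ?V c\<bar> \<le> E t ?f c" by linarith
  then have "\<bar>\<alpha> * (2 * E t ?V x - E t ?V (c - th) - E t ?V c)\<bar> \<le> \<alpha> * E t ?f c"
    using alpha by (simp add: abs_mult)
  moreover have "2 * H t x - H t (c - th) - H t c = (2 * C t x - C t (c - th) - C t c)
      + \<alpha> * (2 * E t ?V x - E t ?V (c - th) - E t ?V c)"
    by (simp add: H_eq[OF t] algebra_simps)
  ultimately have HH: "\<bar>2 * H t x - H t (c - th) - H t c\<bar> \<le> Pb t c"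
    using c by (simp add: Pb_eq[OF t])
  consider "c < s t" | "s t = c" | "s t \<le> c - th"
    using G_gap[OF s_props(1)[OF t] step(3)] by fastforce
  then have "\<bar>2 * V t x - V t (c - th) - V t c\<bar> \<le> fb t c"
  proof cases
    case 1
    then show ?thesis using step th by (simp add: V_def fb_eq)
  next
    case 2
    have "\<bar>V t (c - th) - V t c\<bar> \<le> fb t c"
      using cell_bound[OF t' step(3), of "c - th" c] cell_bound[OF t' step(3), of c "c - th"] th by (simp add: abs_le_iff)
    \<comment> \<open>Left of \<open>s t\<close> the function is constant, so the value at
      \<open>x\<close> is an end value and the estimate reduces to the oscillation.\<close>
    moreover have "V t x = V t c \<or> V t x = V t (c - th)"
      using 2 step th by (cases "x = c") (auto simp: V_def)
    ultimately show ?thesis by linarith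
  next
    case 3
    then show ?thesis using step HH th by (auto simp: V_def fb_eq)
  qed
  then show ?case using HH by simp
qed

text \<open>Read from left to right, \<open>V t\<close> can only drop at \<open>s t\<close>, so an
  increase is governed by \<open>H t\<close> right of \<open>s t\<close>; this yields the smaller
  \<open>f\<close>. It will serve for \<open>x - d\<close> against \<open>x - rd d\<close>, which
  may straddle a cell boundary.\<close>

lemma one_sided_bound:
  assumes "t < T" "c \<in> G" "b \<le> a" "a \<le> c" "a - b \<le> th"
  shows "H t a - H t b \<le> P t c \<and> V t a - V t b \<le> f t c"
  using assms
proof (induction t arbitrary: a b c rule: horizon_induct)
  case last
  note t = L_less
  have ab: "\<bar>a - b\<bar> \<le> th" using last by auto
  have "V L a - V L b \<le> gm L * th"
    using V_last_Lip[of a b] mult_left_mono[OF ab gm_nonneg[OF t]] by linarith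
  then have "V L a - V L b \<le> f L c"
    using last by (auto simp: f_last V_last max_def)
  moreover have "H L a - H L b \<le> P L c"
    using C_Lip'[OF t ab] by (simp only: last_eq P_last)
  ultimately show ?case by simp
next
  case (step t)
  then have t: "Suc t < T" and t': "t < T" by simp_all
  have HH: "H t a - H t b \<le> P t c" if "b \<le> a" "a \<le> c" "a - b \<le> th" for a b
  proof -
    have ab: "\<bar>a - b\<bar> \<le> th" using that by auto
    have "E t (V (Suc t)) a - E t (V (Suc t)) b \<le> E t (f (Suc t)) c"
      by (rule E_diff_le[OF t' V_left_const f_left_const[OF t]])
         (use step that in \<open>auto simp: G_diff\<close>)
    from alpha_mult_mono[OF this] C_Lip'[OF t' ab] show ?thesis
      by (simp add: H_eq[OF t] P_eq[OF t] algebra_simps)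
  qed
  have "V t a - V t b \<le> f t c"
  proof (cases "a \<le> s t")
    case True
    then have "V t a \<le> V t b" using H_at[OF t'] step(4) by (auto simp: V_def)
    then show ?thesis using f_nonneg[OF t' step(3)] by simp
  next
    case False
    then have "f t c = P t c" using step by (simp add: f_eq[OF t])
    moreover have "V t a - V t b \<le> P t c"
      using HH[of b a] HH[of "s t" a] H_at[OF t'] False step by (cases "b < s t") (auto simp: V_def)
    ultimately show ?thesis by simp
  qed
  then show ?case using HH[of b a] step by simp
qed

text \<open>An interval of length \<open>th\<close> meets at most two cells, and \<open>fb\<close>
  is monotone on the grid.\<close>

lemma two_cells_bound:
  assumes t: "t < T" and c: "c \<in> G" and a: "a \<le> c" and b: "b \<le> a" "a - b \<le> th"
  shows "\<bar>V t a - V t b\<bar> \<le> 2 * fb t c"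
proof -
  define u where "u = up a"
  have u: "u \<in> G" "u - th < a" "a \<le> u" "u \<le> c" using up_bounds[of a] up_least[OF c a] by (auto simp: u_def)
  have m: "fb t u \<le> fb t c" "0 \<le> fb t u" using fb_mono[OF t u(1) c u(4)] f_nonneg[OF t u(1)] f_le_fb[OF t u(1)] by auto
  show ?thesis
  proof (cases "u - th \<le> b")
    case True
    then show ?thesis using cell_bound[OF t u(1), of a b] cell_bound[OF t u(1), of b a] u b m by auto
  next
    case False
    have w: "u - th \<in> G" using u by (simp add: G_diff)
    have "fb t (u - th) \<le> fb t u" using fb_mono[OF t w u(1)] th by simp
    then show ?thesis
      using cell_bound[OF t u(1), of a "u - th"] cell_bound[OF t u(1), of "u - th" a]
        cell_bound[OF t w, of "u - th" b] cell_bound[OF t w, of b "u - th"] u b m False th by auto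
  qed
qed

section \<open>Comparison with the optimal cost\<close>

abbreviation "cost \<equiv> ucost M"

text \<open>Adding \<open>cost t * x\<close> removes the linear ordering cost: the recursions then
  have stage cost \<open>C t\<close> and terminal value 0, the same form as that of
  \<open>H t\<close>.\<close>

definition w :: "nat \<Rightarrow> real \<Rightarrow> real" where "w t x = vopt M t x + cost t * x"
definition u :: "nat \<Rightarrow> real \<Rightarrow> real" where "u t x = vpi M th t x + cost t * x"

definition g :: "nat \<Rightarrow> real \<Rightarrow> real" where
  "g t y = C t y + \<alpha> * (\<integral>d. w (Suc t) (y - d) \<partial>dem M t)"

definition gu :: "nat \<Rightarrow> real \<Rightarrow> real" where
  "gu t y = C t y + \<alpha> * (\<integral>d. u (Suc t) (y - d) \<partial>dem M t)"

lemma shift_integrable: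
  assumes t: "t < T" and v: "integrable (dem M t) (\<lambda>d. v (y - d))"
  shows "integrable (dem M t) (\<lambda>d. v (y - d) + c * (y - d))"
  using v dem_int[OF t] dem_const[OF t] by simp

lemma w_integrable: "t < T \<Longrightarrow> integrable (dem M t) (\<lambda>d. w (Suc t) (y - d))"
  unfolding w_def using shift_integrable fin_v by blast

lemma u_integrable: "t < T \<Longrightarrow> integrable (dem M t) (\<lambda>d. u (Suc t) (y - d))"
  unfolding u_def using shift_integrable fin_vpi by blast

lemma stagecost_eq:
  assumes t: "t < T" and v: "integrable (dem M t) (\<lambda>d. v (y - d))"
  shows "stagecost M t x y + \<alpha> * (\<integral>d. v (y - d) \<partial>dem M t) =
    K t * dlt (y - x) + (C t y + \<alpha> * (\<integral>d. v (y - d) + cost (Suc t) * (y - d) \<partial>dem M t)) - cost t * x"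
proof -
  have "(\<integral>d. v (y - d) + cost (Suc t) * (y - d) \<partial>dem M t) =
      (\<integral>d. v (y - d) \<partial>dem M t) + cost (Suc t) * (y - (\<integral>d. d \<partial>dem M t))"
    using v dem_int[OF t] dem_const[OF t] dem_measure[OF t] by simp
  then show ?thesis unfolding stagecost_def Cf_def by (simp only:) (simp add: algebra_simps)
qed

lemma vopt_eq:
  assumes t: "t < T"
  shows "vopt M t x = (INF y\<in>{x..}. K t * dlt (y - x) + g t y - cost t * x)"
proof -
  have "T - t = Suc (T - Suc t)" "T - Suc (T - Suc t) = t" using t by auto
  then have "vopt M t x = (INF y\<in>{x..}. stagecost M t x y + \<alpha> * (\<integral>d. vopt M (Suc t) (y - d) \<partial>dem M t))"
    by (simp add: vopt_def)
  also have "\<dots> = (INF y\<in>{x..}. K t * dlt (y - x) + g t y - cost t * x)"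
    using stagecost_eq[OF t] fin_v t by (simp add: g_def w_def)
  finally show ?thesis .
qed

lemma w_T: "w T x = 0" by (simp add: w_def vopt_def)
lemma u_T: "u T x = 0" by (simp add: u_def vpi_def)

lemma w_greatest:
  assumes t: "t < T" and "B \<le> g t x" "\<And>y. x < y \<Longrightarrow> B \<le> K t + g t y"
  shows "B \<le> w t x"
proof -
  have "B - cost t * x \<le> vopt M t x"
    unfolding vopt_eq[OF t]
  proof (rule cINF_greatest)
    fix y assume "y \<in> {x..}"
    then show "B - cost t * x \<le> K t * dlt (y - x) + g t y - cost t * x"
      using assms by (cases "y = x") (auto simp: dlt_def)
  qed simp
  then show ?thesis by (simp add: w_def)
qed

text \<open>\<open>INF\<close> over the reals is a genuine infimum only for sets bounded below; this
  supplies the bound for \<open>w_le\<close>.\<close>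

lemma g_bounded_below:
  assumes "t < T"
  shows "\<exists>B. \<forall>x. B \<le> g t x"
  using assms
proof (induction t rule: horizon_induct)
  case last
  have "g L x = C L x" for x by (simp add: g_def Suc_L w_T)
  then show ?case using Cm_min[OF L_less] by metis
next
  case (step t)
  then obtain B where B: "B \<le> g (Suc t) x" for x by blast
  have t': "t < T" using step by simp
  have "B \<le> w (Suc t) x" for x
    by (rule w_greatest) (use step B K_nonneg in \<open>auto intro: add_increasing\<close>)
  then have "B \<le> (\<integral>d. w (Suc t) (y - d) \<partial>dem M t)" for y
    using integral_mono[OF dem_const[OF t'] w_integrable[OF t'], of B y] dem_measure[OF t'] by simp
  then have "C t (Cm t) + \<alpha> * B \<le> g t x" for x
    unfolding g_def using Cm_min[OF t'] alpha_mult_mono by (intro add_mono) auto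
  then show ?case by blast
qed

lemma w_le:
  assumes t: "t < T" and y: "x \<le> y"
  shows "w t x \<le> K t * dlt (y - x) + g t y"
proof -
  obtain B where B: "\<And>y. B \<le> g t y" using g_bounded_below[OF t] by blast
  have "bdd_below ((\<lambda>y. K t * dlt (y - x) + g t y - cost t * x) ` {x..})"
    by (rule bdd_belowI2[of _ "B - cost t * x"]) (use B K_nonneg[OF t] in \<open>auto simp: dlt_def intro: add_increasing\<close>)
  then have "vopt M t x \<le> K t * dlt (y - x) + g t y - cost t * x"
    unfolding vopt_eq[OF t] using y by (intro cINF_lower) auto
  then show ?thesis by (simp add: w_def)
qed

lemma w_le_g: "t < T \<Longrightarrow> w t x \<le> g t x"
  using w_le[of t x x] by (simp add: dlt_def)

lemma w_le_K: "t < T \<Longrightarrow> x \<le> y \<Longrightarrow> w t x \<le> K t + g t y"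
  using w_le[of t x y] K_nonneg[of t] by (auto simp: dlt_def split: if_splits)

lemma w_le_K_w: "t < T \<Longrightarrow> x \<le> y \<Longrightarrow> w t x \<le> K t + w t y"
proof -
  assume t: "t < T" and y: "x \<le> y"
  have "w t x - K t \<le> w t y"
  proof (rule w_greatest[OF t])
    show "w t x - K t \<le> g t y" using w_le_K[OF t y] by simp
    show "w t x - K t \<le> K t + g t y'" if "y < y'" for y'
      using w_le_K[OF t, of x y'] y that K_nonneg[OF t] by simp
  qed
  then show ?thesis by simp
qed

text \<open>From the lower stock one setup suffices to imitate the higher one, so the future
  advantage of \<open>y\<close> over \<open>x\<close> is at most
  \<open>\<alpha> * K (Suc t)\<close>, hence at most \<open>K t\<close>. For the exact cost this
  takes the place of K-convexity off the grid.\<close>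

lemma g_diff_ge:
  assumes t: "Suc t < T" and xy: "x \<le> y"
  shows "g t x + C t y - C t x - K t \<le> g t y"
proof -
  have t': "t < T" using t by simp
  have "(\<integral>d. w (Suc t) (x - d) \<partial>dem M t) \<le> (\<integral>d. K (Suc t) + w (Suc t) (y - d) \<partial>dem M t)"
    by (rule integral_mono)
      (use w_integrable[OF t'] dem_const[OF t'] w_le_K_w[OF t] xy in auto)
  then have "(\<integral>d. w (Suc t) (x - d) \<partial>dem M t) \<le> K (Suc t) + (\<integral>d. w (Suc t) (y - d) \<partial>dem M t)"
    using w_integrable[OF t'] dem_const[OF t'] dem_measure[OF t'] by simp
  from alpha_mult_mono[OF this] K_dec[OF t] show ?thesis by (simp add: g_def algebra_simps)
qed

lemma u_eq:
  assumes t: "t < T"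
  shows "u t x = (if x < s t then K t + gu t (S t) else gu t x)"
proof -
  let ?y = "if x < s t then S t else x"
  have "T - t = Suc (T - Suc t)" "T - Suc (T - Suc t) = t" using t by auto
  then have "vpi M th t x = stagecost M t x ?y + \<alpha> * (\<integral>d. vpi M th (Suc t) (?y - d) \<partial>dem M t)"
    by (simp add: vpi_def Let_def)
  also have "\<dots> = K t * dlt (?y - x) + gu t ?y - cost t * x"
    using stagecost_eq[OF t] fin_vpi t by (simp add: gu_def u_def)
  finally show ?thesis using s_le_S[OF t] by (auto simp: u_def dlt_def)
qed

lemma u_last: "u L x = V L x"
proof -
  have "gu L = C L" by (rule ext) (simp add: gu_def Suc_L u_T)
  then show ?thesis by (simp add: u_eq V_def last_eq)
qed

text \<open>With terminal value 0, rounding does not enter the last period, and the exact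
  \<open>s L\<close> and \<open>S L\<close> are optimal on the whole line. The comparison thus
  starts with error 0.\<close>

lemma w_last: "w L x = V L x"
proof -
  have g: "g L = C L" by (rule ext) (simp add: g_def Suc_L w_T)
  note s = sLast_props
  show ?thesis
  proof (cases "x < sLast M")
    case True
    have "w L x \<le> V L x" using w_le_K[OF L_less, of x "Cm L"] True s by (simp add: V_def last_eq g)
    moreover have "V L x \<le> w L x"
      by (rule w_greatest)
        (use True s Cm_min[OF L_less] C_anti[OF L_less, of x "sLast M"] in \<open>auto simp: V_def last_eq g\<close>)
    ultimately show ?thesis by simp
  next
    case False
    have "C L x \<le> K L + C L y" if "x < y" for y
    proof (cases "x \<le> Cm L")
      case True
      then have "C L x \<le> C L (sLast M)" using False by (intro C_anti) auto
      then show ?thesis using s Cm_min[OF L_less, of y] by simp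
    next
      case False
      then show ?thesis using C_mono[OF L_less, of x y] that K_nonneg[OF L_less] by simp
    qed
    then have "C L x \<le> w L x" by (intro w_greatest) (auto simp: g)
    then show ?thesis using w_le_g[OF L_less, of x] False by (simp add: V_def last_eq g)
  qed
qed

section \<open>The accumulated error functions\<close>

abbreviation "omb \<equiv> ombar M th gm"

definition om :: "nat \<Rightarrow> real \<Rightarrow> real" where
  "om t x = P t x - gm t * th + \<alpha> * E t (omb (Suc t)) x"
definition eta :: "nat \<Rightarrow> real" where
  "eta t = Pb t (su t) + om t (su t)"

lemma omb_last: "omb L x = 0" by (simp add: ombar_def L_def)

text \<open>Proved jointly: the series over \<open>omb (Suc t)\<close> is an expectation by
  \<open>E_suminf\<close> once that function is known to be constant far to the left.\<close>

lemma omb_eq: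
  assumes t: "Suc t < T"
  shows "omb t x = (if x \<le> su t then eta t else max (eta t) (om t x)) \<and> left_const (omb t)"
proof -
  have "t < T" using t by simp
  then show ?thesis using t
  proof (induction t arbitrary: x rule: horizon_induct)
    case last then show ?case by simp
  next
    case (step t)
    have "left_const (omb (Suc t))"
    proof (cases "Suc (Suc t) < T")
      case False
      then have "Suc t = L" using step(1) by (simp add: eq_L)
      then show ?thesis using left_constI[of 0 "omb (Suc t)" 0] omb_last by simp
    qed (use step in blast)
    then have E: "(\<Sum>j. omb (Suc t) (y - z (int j - 1)) * fg M th t (int j - 1)) = E t (omb (Suc t)) y" for y
      using step(1) by (intro E_suminf) auto
    have o: "omr M th gm (T - 2 - t) = omb (Suc t)"
      by (rule ext) (simp only: ombar_def index_arith(3)[OF step(1)])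
    have "omr M th gm (T - 1 - t) x = (if x \<le> su t then eta t else max (eta t) (om t x))" for x
      unfolding index_arith(4)[OF step(1)] omr.simps index_arith(2)[OF step(1)] Let_def o E
        eta_def om_def P_def Pb_def ..
    then have eq: "omb t x = (if x \<le> su t then eta t else max (eta t) (om t x))" for x
      by (simp only: ombar_def)
    then have "left_const (omb t)" by (intro left_constI[of "su t" _ "eta t"]) simp
    with eq show ?case by blast
  qed
qed

lemma omb_left_const: assumes "t < T" shows "left_const (omb t)"
proof (cases "Suc t < T")
  case False
  then have "t = L" using assms by (simp add: eq_L)
  then show ?thesis using left_constI[of 0 "omb t" 0] omb_last by simp
qed (use omb_eq in blast)

lemma om_props:
  assumes "t < T" "a \<in> G" "b \<in> G" "a \<le> b"
  shows "0 \<le> omb t a \<and> omb t a \<le> omb t b \<and> (Suc t < T \<longrightarrow> 0 \<le> om t a \<and> om t a \<le> om t b)"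
  using assms
proof (induction t arbitrary: a b rule: horizon_induct)
  case last
  then show ?case by (simp add: omb_last)
next
  case (step t)
  then have t: "Suc t < T" and t': "t < T" by simp_all
  note lc = omb_left_const[OF t]
  have om: "0 \<le> om t a \<and> om t a \<le> om t b" if "a \<in> G" "b \<in> G" "a \<le> b" for a b
  proof -
    have IH: "0 \<le> omb (Suc t) (a - rd d) \<and> omb (Suc t) (a - rd d) \<le> omb (Suc t) (b - rd d)" for d
      using step(2)[of "a - rd d" "b - rd d"] that by (simp add: G_diff)
    have "0 \<le> E t (omb (Suc t)) a" by (rule E_nonneg[OF t']) (use IH in auto)
    moreover have "E t (omb (Suc t)) a \<le> E t (omb (Suc t)) b" by (rule E_mono[OF t' lc lc]) (use IH in auto)
    ultimately show ?thesis
      using P_mono[OF t' that] P_ge[OF t' that(1)] alpha_mult_mono[of 0 "E t (omb (Suc t)) a"]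
        alpha_mult_mono[of "E t (omb (Suc t)) a" "E t (omb (Suc t)) b"]
      by (simp add: om_def)
  qed
  have "su t \<in> G" using su_props(1)[OF t'] .
  then have "0 \<le> eta t" using om[of "su t" "su t"] Pb_nonneg[OF t'] by (simp add: eta_def)
  then show ?case using om[of a b] step(3-) omb_eq[OF t] by (auto simp: max_def)
qed

lemma omb_mono: "t < T \<Longrightarrow> a \<in> G \<Longrightarrow> b \<in> G \<Longrightarrow> a \<le> b \<Longrightarrow> omb t a \<le> omb t b"
  and om_mono: "Suc t < T \<Longrightarrow> a \<in> G \<Longrightarrow> b \<in> G \<Longrightarrow> a \<le> b \<Longrightarrow> om t a \<le> om t b"
  using om_props[of t a] by auto

lemma eta_le_omb: "Suc t < T \<Longrightarrow> eta t \<le> omb t a"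
  using omb_eq by simp

lemma om_le_omb:
  assumes t: "Suc t < T" and a: "a \<in> G"
  shows "om t a \<le> omb t a"
proof (cases "a \<le> su t")
  case True
  have su: "su t \<in> G" using su_props(1) t by simp
  have "om t a \<le> om t (su t)" using om_mono[OF t a su True] .
  also have "\<dots> \<le> eta t" using Pb_nonneg[OF _ su] t by (simp add: eta_def)
  finally show ?thesis using eta_le_omb[OF t, of a] by simp
qed (use omb_eq[OF t] in auto)

section \<open>Upper and lower comparison of w_t with V_t\<close>

lemma g_minus_H_step:
  assumes t: "Suc t < T" and c: "c \<in> G" and ab: "c - th < a" "a \<le> c" "a - real n * th \<le> b" "b \<le> a"
    and IH: "\<And>c a b. c \<in> G \<Longrightarrow> c - th < a \<Longrightarrow> a \<le> c \<Longrightarrow> a - real (Suc n) * th \<le> b \<Longrightarrow> b \<le> a \<Longrightarrow>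
      w (Suc t) b \<le> V (Suc t) a + real (Suc n) * f (Suc t) c + omb (Suc t) c"
  shows "g t b \<le> H t a + real n * P t c + om t c"
proof -
  have t': "t < T" using t by simp
  \<comment> \<open>The distance from \<open>b - d\<close> to \<open>a - rd d\<close> exceeds that
    from \<open>b\<close> to \<open>a\<close> by at most \<open>th\<close>, hence
    \<open>Suc n\<close>. The extra copy of \<open>f\<close> turns into the summand
    \<open>P t c - gm t * th\<close> of \<open>om t c\<close>.\<close>
  have "w (Suc t) (b - d) - V (Suc t) (a - rd d) \<le> real (Suc n) * f (Suc t) (c - rd d) + omb (Suc t) (c - rd d)" for d
    using IH[of "c - rd d" "a - rd d" "b - d"] ab c rd_bounds[of d] by (simp add: G_diff algebra_simps)
  then have "(\<integral>d. w (Suc t) (b - d) \<partial>dem M t) - E t (V (Suc t)) a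
      \<le> real (Suc n) * E t (f (Suc t)) c + E t (omb (Suc t)) c"
    using E_lincomb[OF t' V_left_const V_left_const V_left_const f_left_const[OF t] omb_left_const[OF t] w_integrable[OF t'],
        of 1 b "-1" "Suc t" a 0 "Suc t" a 0 "Suc t" a 0 "real (Suc n)" c 1 c] by simp
  from alpha_mult_mono[OF this] have "\<alpha> * (\<integral>d. w (Suc t) (b - d) \<partial>dem M t) - \<alpha> * E t (V (Suc t)) a
      \<le> real n * (\<alpha> * E t (f (Suc t)) c) + \<alpha> * E t (f (Suc t)) c + \<alpha> * E t (omb (Suc t)) c"
    by (simp add: algebra_simps)
  moreover have "C t b - C t a \<le> gm t * (real n * th)"
    using C_Lip'[OF t', of b a "real n * th"] ab by simp
  ultimately show ?thesis
    by (simp add: g_def H_eq[OF t] om_def P_eq[OF t] algebra_simps)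
qed

lemma w_upper:
  assumes "t < T" "c \<in> G" "c - th < a" "a \<le> c" "a - real n * th \<le> b" "b \<le> a"
  shows "w t b \<le> V t a + real n * f t c + omb t c"
  using assms
proof (induction t arbitrary: a b c n rule: horizon_induct)
  case last
  have nth: "\<bar>b - a\<bar> \<le> real n * th" using last by auto
  have "V L b - V L a \<le> real n * (gm L * th)"
    using V_last_Lip[of b a] mult_left_mono[OF nth gm_nonneg[OF L_less]] by (simp add: algebra_simps)
  then have "V L b \<le> V L a + real n * f L c" using last by (auto simp: f_last V_def)
  then show ?case by (simp add: w_last omb_last)
next
  case (step t)
  then have t: "Suc t < T" and t': "t < T" by simp_all
  have G: "g t b \<le> H t a + real n * P t c + om t c"
    if "c \<in> G" "c - th < a" "a \<le> c" "a - real n * th \<le> b" "b \<le> a" for a b c n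
    by (rule g_minus_H_step[OF t that]) (rule step(2))
  have S: "w t b \<le> K t + H t (S t) + om t (su t)" if "b \<le> S t"
  proof -
    have "g t (S t) \<le> H t (S t) + om t (S t)"
      using G[of "S t" "S t" 0 "S t"] S_props[OF t] th by simp
    moreover have "om t (S t) \<le> om t (su t)"
      using S_props[OF t] su_props(1)[OF t'] by (intro om_mono[OF t])
    ultimately show ?thesis using w_le_K[OF t' that] by simp
  qed
  have su: "su t \<in> G" using su_props(1)[OF t'] .
  have eta: "om t (su t) \<le> omb t c" "Pb t (su t) + om t (su t) \<le> omb t c"
    using eta_le_omb[OF t, of c] Pb_nonneg[OF t' su] by (simp_all add: eta_def)
  have sS: "s t \<le> S t" using s_le_S[OF t'] .
  consider "a < s t" | "s t \<le> a" "s t < c" | "a = s t" "c = s t" using step by force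
  then show ?case
  proof cases
    case 1
    moreover have "0 \<le> real n * f t c" using f_nonneg[OF t' step(3)] by simp
    ultimately show ?thesis using S eta sS step by (simp add: V_def)
  next
    case 2
    then show ?thesis using G[OF step(3-7)] w_le_g[OF t', of b] om_le_omb[OF t step(3)] step(3)
      by (simp add: V_def f_eq[OF t])
  next
    case 3
    have sG: "s t \<in> G" using s_props(1)[OF t] .
    \<comment> \<open>Here \<open>f t c = 0\<close>, so the bound through \<open>g t b\<close> is
      too weak. An order up to \<open>S t\<close> is used instead; the jump of \<open>V t\<close> at
      \<open>s t\<close> is bounded by the cell ending there and paid from
      \<open>eta t\<close>.\<close>
    have "H t (S t) + K t \<le> H t (s t - th)" using sG th by (intro H_below[OF t']) (auto simp: G_diff)
    also have "H t (s t - th) \<le> H t (s t) + Pb t (s t)"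
      using cell_bound[OF t' sG, of "s t - th" "s t"] th by simp
    also have "Pb t (s t) \<le> Pb t (su t)"
      using sS S_props(3)[OF t] by (intro Pb_mono[OF t' sG su]) simp
    finally show ?thesis using S sS eta 3 step by (simp add: V_def f_eq[OF t])
  qed
qed

text \<open>The split at \<open>Cm t\<close>: to its right \<open>C t\<close> is nondecreasing, so
  by \<open>g_diff_ge\<close> no order pays and only \<open>om t c\<close> is lost. To its left the
  cell of \<open>x\<close> ends at or below \<open>su t\<close>, and monotonicity of
  \<open>Pb\<close> and \<open>om\<close> bounds the losses by \<open>eta t\<close>.\<close>

lemma w_lower_step:
  assumes t: "Suc t < T" and c: "c \<in> G" "c - th < x" "x \<le> c"
    and HG: "\<And>c x. c \<in> G \<Longrightarrow> c - th < x \<Longrightarrow> x \<le> c \<Longrightarrow> H t x \<le> g t x + om t c"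
  shows "V t x \<le> w t x + omb t c"
proof -
  have t': "t < T" using t by simp
  note su = su_props[OF t']
  note sG = s_props(1)[OF t] and SG = S_props[OF t]
  have sS: "s t \<le> S t" using s_le_S[OF t'] .
  have eta: "eta t \<le> omb t c" by (rule eta_le_omb[OF t])
  have near: "H t y \<le> g t y + om t (su t)" "up y \<le> su t" "up y \<in> G" "up y - th \<le> y" "y \<le> up y"
    "Pb t (up y) \<le> Pb t (su t)" if "y \<le> su t" for y
  proof -
    show u: "up y \<le> su t" "up y \<in> G" "up y - th \<le> y" "y \<le> up y"
      using up_least[OF su(1) that] up_bounds[of y] by auto
    have "H t y \<le> g t y + om t (up y)" using up_bounds[of y] by (intro HG) auto
    also have "om t (up y) \<le> om t (su t)" using u su(1) by (intro om_mono[OF t])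
    finally show "H t y \<le> g t y + om t (su t)" by simp
    show "Pb t (up y) \<le> Pb t (su t)" using u su(1) by (intro Pb_mono[OF t'])
  qed
  have z0: "zn0 t \<le> su t" using n0_bounds(1)[of t] su(2) by simp
  \<comment> \<open>For the exact cost a target above \<open>su t\<close> is never better than
    \<open>zn0 t\<close>, so losses have to be estimated only for targets up to
    \<open>su t\<close>.\<close>
  have far: "g t (zn0 t) \<le> g t y" if "su t < y" for y
    using g_diff_ge[OF t, of "zn0 t" y] su(3)[of y] that z0 by simp
  have gS_near: "H t (S t) \<le> g t y + eta t" if "y \<le> su t" for y
  proof -
    note u = near[OF that]
    have "H t (S t) \<le> H t (up y)" by (rule H_min[OF t' u(3)])
    also have "\<dots> \<le> H t y + Pb t (up y)" using cell_bound[OF t' u(3), of "up y" y] u th by simp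
    finally show ?thesis using u by (simp add: eta_def)
  qed
  have gS: "H t (S t) \<le> g t y + eta t" for y
    using gS_near[of y] gS_near[OF z0] far[of y] by (cases "y \<le> su t") auto
  consider "x < s t" | "s t \<le> x" "Cm t \<le> x" | "s t \<le> x" "x < Cm t" by linarith
  then show ?thesis
  proof cases
    case 1
    have cs: "c \<le> s t" using G_gap[OF sG c(1)] c 1 by force
    have "H t (S t) + K t - omb t c \<le> w t x"
    proof (rule w_greatest[OF t'])
      have "H t (S t) + K t \<le> H t (c - th)" using c 1 by (intro H_below[OF t']) (auto simp: G_diff)
      also have "\<dots> \<le> H t x + Pb t c" using cell_bound[OF t' c(1), of "c - th" x] c th by simp
      also have "H t x \<le> g t x + om t c" by (rule HG[OF c])
      also have "Pb t c \<le> Pb t (su t)" using cs sS SG(3) su(1) c(1) by (intro Pb_mono[OF t']) auto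
      also have "om t c \<le> om t (su t)" using cs sS SG(3) su(1) c(1) by (intro om_mono[OF t]) auto
      finally show "H t (S t) + K t - omb t c \<le> g t x" using eta by (simp add: eta_def)
      show "H t (S t) + K t - omb t c \<le> K t + g t y" for y using gS[of y] eta by simp
    qed
    then show ?thesis using 1 by (simp add: V_def)
  next
    case 2
    have "g t x \<le> w t x"
    proof (rule w_greatest[OF t'])
      fix y assume "x < y"
      then show "g t x \<le> K t + g t y"
        using g_diff_ge[OF t, of x y] C_mono[OF t', of x y] 2 by simp
    qed simp
    then show ?thesis using HG[OF c] om_le_omb[OF t c(1)] 2 by (simp add: V_def)
  next
    case 3
    have cu: "c \<le> su t" using up_least[OF su(1), of x] up_eq[OF c] 3 su(2) by simp
    have oc: "om t c \<le> om t (su t)" using cu su(1) c(1) by (intro om_mono[OF t])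
    have Pc: "Pb t c \<le> Pb t (su t)" "0 \<le> Pb t (su t)"
      using cu su(1) c(1) Pb_nonneg[OF t'] Pb_mono[OF t'] by auto
    have mid: "H t x \<le> K t + H t y + Pb t (su t)" if y: "x < y" "y \<le> su t" for y
    proof -
      note u = near[OF y(2)]
      have ccy: "c \<le> up y" using up_least[OF u(3), of x] up_eq[OF c] y u by simp
      show ?thesis
      \<comment> \<open>\<open>H_no_order\<close> requires both cell ends at or right of
        \<open>s t\<close>. If the left end fails this, the grid gap gives \<open>c\<close> at most
        \<open>s t\<close>, and \<open>x\<close> is the grid point \<open>s t\<close>
        itself.\<close>
      proof (cases "s t \<le> c - th")
        case True
        have "2 * H t x \<le> H t (c - th) + H t c + Pb t c"
          using cell_midpoint_bound[OF t' c(1), of x] c by (simp add: abs_le_iff)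
        moreover have "H t (c - th) \<le> K t + H t (up y - th)"
          using True ccy c(1) u(3) by (intro H_no_order[OF t']) (auto simp: G_diff)
        moreover have "H t c \<le> K t + H t (up y)"
          using True ccy c(1) u(3) th by (intro H_no_order[OF t']) auto
        moreover have "H t (up y - th) + H t (up y) \<le> 2 * H t y + Pb t (up y)"
          using cell_midpoint_bound[OF t' u(3), of y] u by (simp add: abs_le_iff)
        ultimately show ?thesis using Pc u by simp
      next
        case False
        then have "c \<le> s t" using G_gap[OF sG c(1)] by force
        then have "x = s t" using c 3 by simp
        then have "H t x \<le> K t + H t (up y)" using H_at[OF t'] H_min[OF t' u(3)] by simp
        moreover have "H t (up y) \<le> H t y + Pb t (up y)"
          using cell_bound[OF t' u(3), of "up y" y] u th by simp
        ultimately show ?thesis using u by simp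
      qed
    qed
    have order: "H t x - eta t \<le> K t + g t y" if "x < y" "y \<le> su t" for y
      using mid[OF that] near(1)[OF that(2)] by (simp add: eta_def)
    have "H t x - eta t \<le> w t x"
    proof (rule w_greatest[OF t'])
      show gx: "H t x - eta t \<le> g t x" using HG[OF c] oc Pc by (simp add: eta_def)
      fix y assume y: "x < y"
      show "H t x - eta t \<le> K t + g t y"
      proof (cases "y \<le> su t")
        case True
        then show ?thesis by (rule order[OF y])
      next
        case False
        show ?thesis
        \<comment> \<open>For \<open>x\<close> below \<open>zn0 t\<close> the target is replaced by
          \<open>zn0 t\<close>. Otherwise \<open>x\<close> lies between \<open>zn0 t\<close> and
          \<open>Cm t\<close>, so \<open>C t x\<close> is at most \<open>C t (zn0 t)\<close>, and
          staying at \<open>x\<close> costs no more than being at \<open>y\<close>.\<close>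
        proof (cases "x < zn0 t")
          case True
          then show ?thesis using order[OF True z0] far[of y] False by simp
        next
          case False': False
          have "C t x \<le> C t (zn0 t)" using False' 3 by (intro C_anti[OF t']) auto
          then show ?thesis
            using g_diff_ge[OF t, of x y] su(3)[of y] False y gx K_nonneg[OF t'] by simp
        qed
      qed
    qed
    then show ?thesis using eta 3 by (simp add: V_def)
  qed
qed

lemma w_lower:
  assumes "t < T" "c \<in> G" "c - th < x" "x \<le> c"
  shows "V t x \<le> w t x + omb t c"
  using assms
proof (induction t arbitrary: x c rule: horizon_induct)
  case last
  then show ?case by (simp add: w_last omb_last)
next
  case (step t)
  then have t: "Suc t < T" and t': "t < T" by simp_all
  have "H t x \<le> g t x + om t c" if c: "c \<in> G" "c - th < x" "x \<le> c" for c x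
  proof -
    \<comment> \<open>The passage from \<open>x - rd d\<close> down to \<open>x - d\<close> is
      one-sided and costs only \<open>f\<close>; the induction hypothesis then applies at
      \<open>x - d\<close>, whose cell ends no later than \<open>c - rd d\<close>.\<close>
    have "V (Suc t) (x - rd d) - w (Suc t) (x - d) \<le> f (Suc t) (c - rd d) + omb (Suc t) (c - rd d)" for d
    proof -
      have cd: "c - rd d \<in> G" using c by (simp add: G_diff)
      have "V (Suc t) (x - rd d) - V (Suc t) (x - d) \<le> f (Suc t) (c - rd d)"
        using one_sided_bound[OF t cd, of "x - d" "x - rd d"] rd_bounds[of d] c by simp
      moreover have "V (Suc t) (x - d) \<le> w (Suc t) (x - d) + omb (Suc t) (up (x - d))"
        using up_bounds[of "x - d"] by (intro step(2)) auto
      moreover have "omb (Suc t) (up (x - d)) \<le> omb (Suc t) (c - rd d)"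
        using up_least[OF cd, of "x - d"] rd_bounds[of d] c cd by (intro omb_mono[OF t]) auto
      ultimately show ?thesis by simp
    qed
    then have "E t (V (Suc t)) x - (\<integral>d. w (Suc t) (x - d) \<partial>dem M t)
        \<le> E t (f (Suc t)) c + E t (omb (Suc t)) c"
      using E_lincomb[OF t' V_left_const V_left_const V_left_const f_left_const[OF t] omb_left_const[OF t] w_integrable[OF t'],
        of "-1" x 1 "Suc t" x 0 "Suc t" x 0 "Suc t" x 0 1 c 1 c] by simp
    from alpha_mult_mono[OF this] show ?thesis
      by (simp add: g_def H_eq[OF t] om_def P_eq[OF t] algebra_simps)
  qed
  then show ?case by (rule w_lower_step[OF t step(3-5)])
qed

lemma V_minus_w: "t < T \<Longrightarrow> c \<in> G \<Longrightarrow> c - th < x \<Longrightarrow> x \<le> c \<Longrightarrow> \<bar>V t x - w t x\<bar> \<le> omb t c"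
  using w_lower[of t c x] w_upper[of t c x 0 x] by (simp add: abs_le_iff)

section \<open>Comparison with the policy cost\<close>

abbreviation "eps \<equiv> epsbar M th gm"

lemma lam_Suc: "lam M th t y (Suc i) = lam M th (Suc t) (max y (S t) + th) i"
  by (induction i) simp_all

lemma eps_last: "Suc t = L \<Longrightarrow> eps t y = \<alpha> * gm L * th"
  by (simp add: epsbar_def L_def)

lemma eps_step:
  assumes t: "Suc t < L"
  shows "eps t y = 2 * (Pb t (max y (S t)) - gm t * th) + \<alpha> * eps (Suc t) (max y (S t) + th)"
proof -
  have n: "T - 1 - t = Suc (T - 1 - Suc t)" "T - 2 - t = Suc (T - 2 - Suc t)"
    using t by (auto simp: L_def)
  show ?thesis
    unfolding epsbar_def n sum.lessThan_Suc_shift lam_Suc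
    by (simp add: Pb_def distrib_left sum_distrib_left mult.assoc mult.left_commute)
qed

text \<open>Both costs belong to the same ordering rule, so no minimizations are compared; the
  difference stems from \<open>d\<close> against \<open>rd d\<close> alone.\<close>

lemma u_minus_V:
  assumes "t < T" "Suc t < T" "c \<in> G" "x \<le> c"
  shows "\<bar>u t x - V t x\<bar> \<le> eps t c"
  using assms
proof (induction t arbitrary: x c rule: horizon_induct)
  case last then show ?case by simp
next
  case (step t)
  then have t: "Suc t < T" and t': "t < T" by simp_all
  \<comment> \<open>\<open>Z\<close> dominates both possible stocks after the ordering decision,
    \<open>x\<close> and \<open>S t\<close>, and \<open>Z + th\<close> is the next argument in the
    recursion of \<open>lam\<close>.\<close>
  define Z where "Z = max c (S t)"
  have Z: "Z \<in> G" using step(4) S_props(1)[OF t] by (simp add: Z_def max_def)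
  have gH: "\<bar>gu t y - H t y\<bar> \<le> eps t c" if y: "y \<le> Z" for y
  proof -
    \<comment> \<open>If the next period is the last, its cost is Lipschitz and
      \<open>k = 0\<close>. Earlier, the step from \<open>d\<close> to \<open>rd d\<close> may touch
      two cells, which is the factor 2 in \<open>epsbar\<close>.\<close>
    obtain b k where bk: "\<And>d. 0 \<le> d \<Longrightarrow> \<bar>u (Suc t) (y - d) - V (Suc t) (y - rd d)\<bar> \<le> b + k * fb (Suc t) (Z - rd d)"
      and eps: "eps t c = \<alpha> * (b + k * E t (fb (Suc t)) Z)"
    proof (cases "Suc t = L")
      case True
      have "\<bar>u (Suc t) (y - d) - V (Suc t) (y - rd d)\<bar> \<le> gm L * th + 0 * fb (Suc t) (Z - rd d)" for d
      proof -
        have d: "\<bar>(y - d) - (y - rd d)\<bar> \<le> th" using rd_bounds[of d] by auto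
        show ?thesis
          using V_last_Lip[of "y - d" "y - rd d"] mult_left_mono[OF d gm_nonneg[OF L_less]] True
          by (simp add: u_last)
      qed
      then show ?thesis using that[of "gm L * th" 0] eps_last[OF True, of c] by simp
    next
      case False
      then have t2: "Suc (Suc t) < T" using t eq_L by blast
      then have tL: "Suc t < L" using Suc_L by simp
      have "\<bar>u (Suc t) (y - d) - V (Suc t) (y - rd d)\<bar> \<le> eps (Suc t) (Z + th) + 2 * fb (Suc t) (Z - rd d)"
        if "0 \<le> d" for d
      proof -
        have "\<bar>u (Suc t) (y - d) - V (Suc t) (y - d)\<bar> \<le> eps (Suc t) (Z + th)"
          using step(2)[OF t2, of "Z + th" "y - d"] Z y that th by (simp add: G_add)
        moreover have "\<bar>V (Suc t) (y - rd d) - V (Suc t) (y - d)\<bar> \<le> 2 * fb (Suc t) (Z - rd d)"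
          using rd_bounds[of d] y Z by (intro two_cells_bound[OF t]) (auto simp: G_diff)
        ultimately show ?thesis by linarith
      qed
      then show ?thesis
        using that[of "eps (Suc t) (Z + th)" 2] eps_step[OF tL, of c] Pb_eq[OF t, of Z]
        by (simp add: Z_def[symmetric] algebra_simps)
    qed
    note lin = E_lincomb[OF t' V_left_const V_left_const V_left_const fb_left_const[OF t] fb_left_const[OF t] u_integrable[OF t']]
    have bk1: "u (Suc t) (y - d) - V (Suc t) (y - rd d) \<le> b + k * fb (Suc t) (Z - rd d)"
      and bk2: "V (Suc t) (y - rd d) - u (Suc t) (y - d) \<le> b + k * fb (Suc t) (Z - rd d)" if "0 \<le> d" for d
      using bk[OF that] by linarith+
    let ?I = "\<integral>d. u (Suc t) (y - d) \<partial>dem M t"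
    have "?I - E t (V (Suc t)) y \<le> b + k * E t (fb (Suc t)) Z"
      using lin[of 1 y "-1" "Suc t" y 0 "Suc t" y 0 "Suc t" y b k Z 0 Z] bk1 by simp
    moreover have "E t (V (Suc t)) y - ?I \<le> b + k * E t (fb (Suc t)) Z"
      using lin[of "-1" y 1 "Suc t" y 0 "Suc t" y 0 "Suc t" y b k Z 0 Z] bk2 by simp
    ultimately have "\<bar>?I - E t (V (Suc t)) y\<bar> \<le> b + k * E t (fb (Suc t)) Z" by linarith
    then have "\<bar>\<alpha> * (?I - E t (V (Suc t)) y)\<bar> \<le> \<alpha> * (b + k * E t (fb (Suc t)) Z)"
      using alpha by (simp add: abs_mult)
    moreover have "gu t y - H t y = \<alpha> * (?I - E t (V (Suc t)) y)"
      by (simp add: gu_def H_eq[OF t] algebra_simps)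
    ultimately show ?thesis using eps by simp
  qed
  show ?case
    using gH[of "S t"] gH[of x] step(5) by (auto simp: u_eq[OF t'] V_def Z_def)
qed

section \<open>Explicit bounds\<close>

text \<open>For a stock of at most \<open>y + real m * th\<close> in period \<open>t + m\<close>,
  the factor with index \<open>m\<close> bounds the probability that rounded demand leaves the next
  stock at or above its threshold, where an error is passed on.\<close>

definition cdf_prod :: "nat \<Rightarrow> nat \<Rightarrow> real \<Rightarrow> real" where
  "cdf_prod t n y = (\<Prod>m<n. cdf M (t + m) (y + real (m + 1) * th - s (t + m + 1)))"

lemma cdf_prod_bounds: "t + n \<le> T \<Longrightarrow> 0 \<le> cdf_prod t n y \<and> cdf_prod t n y \<le> 1"
  unfolding cdf_prod_def by (auto intro!: prod_nonneg prod_le_1 cdf_nonneg cdf_le_1)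

lemma cdf_prod_Suc:
  "cdf_prod t (Suc n) y = cdf M t (y + th - s (Suc t)) * cdf_prod (Suc t) n (y + th)"
  by (simp add: cdf_prod_def prod.lessThan_Suc_shift algebra_simps del: prod.lessThan_Suc)

text \<open>\<open>fb\<close> vanishes below \<open>s (Suc t)\<close>, so only demands up to
  \<open>c + th - s (Suc t)\<close> contribute, and the argument \<open>c - rd d\<close> is at most
  \<open>c + th\<close>.\<close>

lemma Pb_step:
  assumes t: "Suc t < T" and c: "c \<in> G"
  shows "Pb t c \<le> gm t * th + \<alpha> * (cdf M t (c + th - s (Suc t)) * Pb (Suc t) (c + th))"
proof -
  have t': "t < T" using t by simp
  have cth: "c + th \<in> G" using c by (simp add: G_add)
  have "E t (fb (Suc t)) c \<le> cdf M t (c - s (Suc t) + th) * Pb (Suc t) (c + th)"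
  proof (rule E_cutoff_le_cdf[OF t' Pb_nonneg[OF t cth] fb_left_const[OF t]])
    fix d :: real
    have cd: "c - rd d \<in> G" using c by (simp add: G_diff)
    show "fb (Suc t) (c - rd d) \<le> Pb (Suc t) (c + th)" if "0 \<le> d"
      using Pb_mono[OF t cd cth] Pb_nonneg[OF t cth] rd_ge[OF that] by (simp add: fb_eq[OF t cd])
    show "fb (Suc t) (c - rd d) \<le> 0" if "c - s (Suc t) < rd d"
      using that by (simp add: fb_eq[OF t cd])
  qed
  from alpha_mult_mono[OF this] show ?thesis by (simp add: Pb_eq[OF t] algebra_simps)
qed

lemma Pb_le:
  assumes "t < T" "c \<in> G"
  shows "Pb t c \<le> gm t * th + th * (\<Sum>n\<in>{1..T - 1 - t}. \<alpha> ^ n * gm (t + n) * cdf_prod t n c)"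
  using assms
proof (induction t arbitrary: c rule: horizon_induct)
  case last
  have "{1..T - 1 - L} = {}" by (simp add: L_def)
  then show ?case by (simp only: Pb_last sum.empty)
next
  case (step t)
  have n: "T - 1 - t = Suc (T - 1 - Suc t)" using step(1) by simp
  let ?F = "cdf M t (c + th - s (Suc t))"
  let ?N = "T - 1 - Suc t"
  let ?Q = "\<Sum>n\<in>{1..?N}. \<alpha> ^ n * gm (Suc t + n) * cdf_prod (Suc t) n (c + th)"
  have "?F * Pb (Suc t) (c + th) \<le> ?F * (gm (Suc t) * th + th * ?Q)"
    using step by (intro mult_left_mono cdf_nonneg) (simp_all add: G_add)
  from alpha_mult_mono[OF this] Pb_step[OF step(1,3)]
  have le: "Pb t c \<le> gm t * th + \<alpha> * (?F * (gm (Suc t) * th + th * ?Q))" by linarith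
  let ?R = "\<Sum>n\<in>{1..?N}. \<alpha> ^ Suc n * gm (t + Suc n) * cdf_prod t (Suc n) c"
  have "\<alpha> * (?F * (th * ?Q)) = th * ?R"
    by (simp add: cdf_prod_Suc sum_distrib_left mult_ac)
  then have "\<alpha> * (?F * (gm (Suc t) * th + th * ?Q)) = th * (\<alpha> * gm (Suc t) * ?F + ?R)"
    by (simp only: distrib_left) (simp only: mult_ac)
  also have "\<alpha> * gm (Suc t) * ?F = \<alpha> ^ Suc 0 * gm (t + Suc 0) * cdf_prod t (Suc 0) c"
    by (simp only: cdf_prod_Suc) (simp add: cdf_prod_def)
  also have "\<alpha> ^ Suc 0 * gm (t + Suc 0) * cdf_prod t (Suc 0) c + ?R
      = (\<Sum>n\<in>{1..T - 1 - t}. \<alpha> ^ n * gm (t + n) * cdf_prod t n c)"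
    unfolding n unfolding One_nat_def sum.atLeast1_atMost_eq sum.lessThan_Suc_shift by simp
  finally show ?case using le by simp
qed

lemma Pb_minus_le:
  assumes t: "t < T" and c: "c \<in> G"
  shows "\<alpha> ^ t * (Pb t c - gm t * th) \<le>
    th * (\<Sum>n\<in>{1..T - 1 - t}. \<alpha> ^ (n + t) * gm (t + n) * cdf_prod t n c)"
proof -
  have "\<alpha> ^ t * (Pb t c - gm t * th) \<le>
      \<alpha> ^ t * (th * (\<Sum>n\<in>{1..T - 1 - t}. \<alpha> ^ n * gm (t + n) * cdf_prod t n c))"
    using Pb_le[OF assms] alpha by (intro mult_left_mono) auto
  then show ?thesis
    by (simp add: sum_distrib_left power_add mult.assoc mult.left_commute)
qed

text \<open>Evaluating \<open>om\<close> at \<open>max c (su t)\<close> covers both branches of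
  \<open>omb\<close>. The next argument grows by \<open>th\<close> since a rounded demand can be
  \<open>- th\<close>; this is the recursion of \<open>mu0\<close>.\<close>

lemma omb_step:
  assumes t: "Suc t < T" and c: "c \<in> G"
  shows "omb t c \<le> gm t * th + (Pb t (su t) - gm t * th) + (Pb t (max c (su t)) - gm t * th)
    + \<alpha> * omb (Suc t) (max c (su t) + th)"
proof -
  have t': "t < T" using t by simp
  have su: "su t \<in> G" using su_props(1)[OF t'] .
  define y where "y = max c (su t)"
  have y: "y \<in> G" "su t \<le> y" using c su by (auto simp: y_def max_def)
  have "E t (omb (Suc t)) y \<le> E t (\<lambda>_. omb (Suc t) (y + th)) y"
  proof (rule E_mono[OF t' omb_left_const[OF t] left_const_const])
    fix d :: real assume "0 \<le> d"
    then show "omb (Suc t) (y - rd d) \<le> omb (Suc t) (y + th)"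
      using y rd_ge[of d] by (intro omb_mono[OF t]) (auto simp: G_add G_diff)
  qed
  then have "om t y \<le> Pb t y - gm t * th + \<alpha> * omb (Suc t) (y + th)"
    using P_le_Pb[OF t' y(1)] alpha_mult_mono by (fastforce simp: om_def E_const[OF t'] intro: add_mono)
  moreover have "omb t c \<le> Pb t (su t) + om t y"
    using omb_eq[OF t, of c] om_mono[OF t su y] Pb_nonneg[OF t' su]
    by (cases "c \<le> su t") (auto simp: y_def eta_def max_def)
  ultimately show ?thesis by (simp add: y_def)
qed

lemma mu0_in: "c \<in> G \<Longrightarrow> i \<le> T \<Longrightarrow> mu0 M th c i \<in> G"
proof (induction i)
  case (Suc i)
  then show ?case using su_props(1)[of i] by (auto simp: max_def intro!: G_add)
qed simp

lemma lam_in: "c \<in> G \<Longrightarrow> i < L \<Longrightarrow> lam M th 0 c i \<in> G"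
proof (induction i)
  case (Suc i)
  then show ?case using S_props(1)[of i] Suc_L by (auto simp: max_def intro!: G_add)
qed simp

lemma omb_iterate:
  assumes c: "c \<in> G" and "j \<le> L"
  shows "omb 0 c \<le> (\<Sum>i<j. \<alpha> ^ i * (gm i * th + (Pb i (su i) - gm i * th)
      + (Pb i (max (mu0 M th c i) (su i)) - gm i * th))) + \<alpha> ^ j * omb j (mu0 M th c j)"
  using assms(2)
proof (induction j)
  case (Suc j)
  have "\<alpha> ^ j * omb j (mu0 M th c j) \<le> \<alpha> ^ j * (gm j * th + (Pb j (su j) - gm j * th)
      + (Pb j (max (mu0 M th c j) (su j)) - gm j * th) + \<alpha> * omb (Suc j) (mu0 M th c (Suc j)))"
    using omb_step[of j "mu0 M th c j"] mu0_in[OF c, of j] Suc Suc_L alpha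
    by (intro mult_left_mono) auto
  then show ?case using Suc by (simp add: algebra_simps)
qed simp

lemma Uom0_bound:
  assumes c: "c \<in> G"
  shows "omb 0 c \<le> Uom0 M th gm c"
proof -
  let ?D = "\<lambda>i y. \<Sum>n\<in>{1..T - 1 - i}. \<alpha> ^ (n + i) * gm (i + n) * cdf_prod i n y"
  have "omb 0 c \<le> (\<Sum>i<L. \<alpha> ^ i * (gm i * th + (Pb i (su i) - gm i * th)
      + (Pb i (max (mu0 M th c i) (su i)) - gm i * th)))"
    using omb_iterate[OF c, of L] by (simp add: omb_last)
  also have "\<dots> \<le> (\<Sum>i<L. th * (\<alpha> ^ i * gm i) + th * (?D i (su i) + ?D i (max (mu0 M th c i) (su i))))"
  proof (rule sum_mono)
    fix i assume "i \<in> {..<L}"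
    then have i: "i < T" by (auto intro: less_trans[OF _ L_less])
    have "su i \<in> G" "max (mu0 M th c i) (su i) \<in> G"
      using su_props(1)[OF i] mu0_in[OF c, of i] i by (auto simp: max_def)
    from Pb_minus_le[OF i this(1)] Pb_minus_le[OF i this(2)]
    show "\<alpha> ^ i * (gm i * th + (Pb i (su i) - gm i * th) + (Pb i (max (mu0 M th c i) (su i)) - gm i * th))
      \<le> th * (\<alpha> ^ i * gm i) + th * (?D i (su i) + ?D i (max (mu0 M th c i) (su i)))"
      by (simp add: algebra_simps)
  qed
  also have "\<dots> = Uom0 M th gm c"
    by (simp add: Uom0_def L_def cdf_prod_def sum.distrib sum_distrib_left distrib_left)
  finally show ?thesis .
qed

lemma Ueps0_bound:
  assumes c: "c \<in> G"
  shows "eps 0 c \<le> Ueps0 M th gm c"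
proof -
  let ?D = "\<lambda>i y. \<Sum>n\<in>{1..T - 1 - i}. \<alpha> ^ (n + i) * gm (i + n) * cdf_prod i n y"
  let ?y = "\<lambda>i. max (lam M th 0 c i) (S i)"
  have "(\<Sum>i<T - 2. 2 * (\<alpha> ^ i * (Pb i (?y i) - gm i * th))) \<le> (\<Sum>i<T - 2. 2 * (th * ?D i (?y i)))"
  proof (intro sum_mono mult_left_mono)
    fix i assume "i \<in> {..<T - 2}"
    then have i: "Suc i < T" "i < L" using Suc_L by auto
    have "?y i \<in> G" using S_props(1)[OF i(1)] lam_in[OF c i(2)] by (auto simp: max_def)
    then show "\<alpha> ^ i * (Pb i (?y i) - gm i * th) \<le> th * ?D i (?y i)"
      using i by (intro Pb_minus_le) auto
  qed simp
  moreover have "eps 0 c = \<alpha> ^ (T - 1) * gm (T - 1) * th + (\<Sum>i<T - 2. 2 * (\<alpha> ^ i * (Pb i (?y i) - gm i * th)))"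
    by (simp add: epsbar_def Pb_def mult.assoc)
  moreover have "Ueps0 M th gm c = \<alpha> ^ (T - 1) * gm (T - 1) * th + (\<Sum>i<T - 2. 2 * (th * ?D i (?y i)))"
    by (simp add: Ueps0_def cdf_prod_def sum_distrib_left mult.assoc)
  ultimately show ?thesis by linarith
qed

lemma discounted_gm_nonneg: "i + n < T \<Longrightarrow> 0 \<le> \<alpha> ^ (n + i) * gm (i + n)"
  using gm_nonneg[of "i + n"] alpha by simp

lemma Uom0_le: "Uom0 M th gm c \<le> Uombar0 M gm th"
proof -
  have "(\<Sum>i<T - 1. \<Sum>n\<in>{1..T - 1 - i}. \<alpha> ^ (n + i) * gm (i + n) *
        (cdf_prod i n (su i) + cdf_prod i n (max (mu0 M th c i) (su i))))
      \<le> (\<Sum>i<T - 1. \<Sum>n\<in>{1..T - 1 - i}. \<alpha> ^ (n + i) * gm (i + n) * 2)"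
  proof (intro sum_mono mult_left_mono)
    fix i n assume "i \<in> {..<T - 1}" "n \<in> {1..T - 1 - i}"
    then have "i + n < T" by auto
    then show "0 \<le> \<alpha> ^ (n + i) * gm (i + n)" by (rule discounted_gm_nonneg)
    show "cdf_prod i n (su i) + cdf_prod i n (max (mu0 M th c i) (su i)) \<le> 2"
      using cdf_prod_bounds[of i n "su i"] cdf_prod_bounds[of i n "max (mu0 M th c i) (su i)"] \<open>i + n < T\<close>
      by simp
  qed
  also have "\<dots> = 2 * (\<Sum>i<T - 1. \<Sum>n\<in>{1..T - 1 - i}. \<alpha> ^ (n + i) * gm (i + n))"
    by (simp add: sum_distrib_left mult.commute)
  finally have "th * (\<Sum>i<T - 1. \<Sum>n\<in>{1..T - 1 - i}. \<alpha> ^ (n + i) * gm (i + n) *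
        (cdf_prod i n (su i) + cdf_prod i n (max (mu0 M th c i) (su i))))
      \<le> th * (2 * (\<Sum>i<T - 1. \<Sum>n\<in>{1..T - 1 - i}. \<alpha> ^ (n + i) * gm (i + n)))"
    using th by (intro mult_left_mono) auto
  then show ?thesis by (simp add: Uom0_def Uombar0_def cdf_prod_def)
qed

lemma Ueps0_le: "Ueps0 M th gm c \<le> Uepsbar0 M gm th"
proof -
  have "(\<Sum>i<T - 2. \<Sum>n\<in>{1..T - 1 - i}. \<alpha> ^ (n + i) * gm (i + n) * cdf_prod i n (max (lam M th 0 c i) (S i)))
      \<le> (\<Sum>i<T - 2. \<Sum>n\<in>{1..T - 1 - i}. \<alpha> ^ (n + i) * gm (i + n) * 1)"
  proof (intro sum_mono mult_left_mono)
    fix i n assume "i \<in> {..<T - 2}" "n \<in> {1..T - 1 - i}"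
    then have "i + n < T" by auto
    then show "0 \<le> \<alpha> ^ (n + i) * gm (i + n)" by (rule discounted_gm_nonneg)
    show "cdf_prod i n (max (lam M th 0 c i) (S i)) \<le> 1"
      using cdf_prod_bounds[of i n] \<open>i + n < T\<close> by simp
  qed
  then show ?thesis using th by (simp add: Ueps0_def Uepsbar0_def cdf_prod_def)
qed

lemma vpi_minus_vopt:
  assumes "c \<in> G" "c - th < x" "x \<le> c"
  shows "\<bar>vpi M th 0 x - vopt M 0 x\<bar> \<le> omb 0 c + eps 0 c"
proof -
  have "\<bar>u 0 x - V 0 x\<bar> \<le> eps 0 c" using T3 assms by (intro u_minus_V) auto
  moreover have "\<bar>V 0 x - w 0 x\<bar> \<le> omb 0 c" using T3 assms by (intro V_minus_w) auto
  moreover have "vpi M th 0 x - vopt M 0 x = (u 0 x - V 0 x) + (V 0 x - w 0 x)"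
    by (simp add: u_def w_def)
  ultimately show ?thesis by linarith
qed

lemma error_chain:
  assumes "c \<in> G" "c - th < x" "x \<le> c"
  shows "\<bar>vpi M th 0 x - vopt M 0 x\<bar> \<le> omb 0 c + eps 0 c"
    "omb 0 c + eps 0 c \<le> Uom0 M th gm c + Ueps0 M th gm c"
    "Uom0 M th gm c + Ueps0 M th gm c \<le> Uombar0 M gm th + Uepsbar0 M gm th"
  using vpi_minus_vopt[OF assms] Uom0_bound[OF assms(1)] Ueps0_bound[OF assms(1)] Uom0_le[of c] Ueps0_le[of c]
  by linarith+

end

theorem theorem4p6:
  fixes M :: invmodel and gm :: "nat \<Rightarrow> real"
  assumes T3: "hor M \<ge> 3"
    and alpha: "0 < disc M" "disc M \<le> 1"
    and Knonneg: "\<forall>t<hor M. scost M t \<ge> 0"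
    and Kdec: "\<forall>t. t + 2 \<le> hor M \<longrightarrow> scost M t \<ge> disc M * scost M (Suc t)"
    and demand: "\<forall>t<hor M. prob_space (dem M t) \<and> sets (dem M t) = sets borel \<and>
                   (AE d in dem M t. 0 \<le> d) \<and> integrable (dem M t) (\<lambda>d. d)"
    and Cconv: "\<forall>t<hor M. convex_on UNIV (Cf M t) \<and> filterlim (Cf M t) at_top at_infinity"
    and Lip: "\<forall>t<hor M. gm t \<ge> 0 \<and> (\<forall>x y. \<bar>Cf M t x - Cf M t y\<bar> \<le> gm t * \<bar>x - y\<bar>)"
    and fin_v: "\<forall>t<hor M. \<forall>y. integrable (dem M t) (\<lambda>d. vopt M (Suc t) (y - d))"
    and fin_vpi: "\<forall>th>0. \<forall>t<hor M. \<forall>y. integrable (dem M t) (\<lambda>d. vpi M th (Suc t) (y - d))"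
  shows "(\<forall>th>0. \<forall>(k::int) (x::real). zg th (k - 1) < x \<and> x \<le> zg th k \<longrightarrow>
            \<bar>vpi M th 0 x - vopt M 0 x\<bar> \<le> ombar M th gm 0 (zg th k) + epsbar M th gm 0 (zg th k)
          \<and> ombar M th gm 0 (zg th k) + epsbar M th gm 0 (zg th k)
              \<le> Uom0 M th gm (zg th k) + Ueps0 M th gm (zg th k)
          \<and> Uom0 M th gm (zg th k) + Ueps0 M th gm (zg th k) \<le> Uombar0 M gm th + Uepsbar0 M gm th)
       \<and> ((\<lambda>th. SUP x. \<bar>vpi M th 0 x - vopt M 0 x\<bar>) \<longlongrightarrow> 0) (at_right 0)"
proof
  have grid: "inventory_grid M gm th" if "0 < th" for th
    by unfold_locales (use assms that in blast)+
  show "\<forall>th>0. \<forall>(k::int) (x::real). zg th (k - 1) < x \<and> x \<le> zg th k \<longrightarrow>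
            \<bar>vpi M th 0 x - vopt M 0 x\<bar> \<le> ombar M th gm 0 (zg th k) + epsbar M th gm 0 (zg th k)
          \<and> ombar M th gm 0 (zg th k) + epsbar M th gm 0 (zg th k)
              \<le> Uom0 M th gm (zg th k) + Ueps0 M th gm (zg th k)
          \<and> Uom0 M th gm (zg th k) + Ueps0 M th gm (zg th k) \<le> Uombar0 M gm th + Uepsbar0 M gm th"
  proof (intro allI impI)
    fix th :: real and k :: int and x :: real
    assume "0 < th" and x: "zg th (k - 1) < x \<and> x \<le> zg th k"
    interpret inventory_grid M gm th by (rule grid) fact
    show "\<bar>vpi M th 0 x - vopt M 0 x\<bar> \<le> ombar M th gm 0 (zg th k) + epsbar M th gm 0 (zg th k)
          \<and> ombar M th gm 0 (zg th k) + epsbar M th gm 0 (zg th k)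
              \<le> Uom0 M th gm (zg th k) + Ueps0 M th gm (zg th k)
          \<and> Uom0 M th gm (zg th k) + Ueps0 M th gm (zg th k) \<le> Uombar0 M gm th + Uepsbar0 M gm th"
      using x by (intro conjI error_chain) (auto simp: z_diff)
  qed
  \<comment> \<open>The final bounds are independent of the cell and linear in the grid width, so
    their value at width 1 is the constant of the rate.\<close>
  define c where "c = Uombar0 M gm 1 + Uepsbar0 M gm 1"
  have bound: "\<bar>vpi M th 0 x - vopt M 0 x\<bar> \<le> th * c" if "0 < th" for th x
  proof -
    interpret inventory_grid M gm th by (rule grid) fact
    have "\<bar>vpi M th 0 x - vopt M 0 x\<bar> \<le> Uombar0 M gm th + Uepsbar0 M gm th"
      using error_chain[OF up_in up_bounds(2,1), of x] by linarith
    also have "\<dots> = th * c"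
      by (simp add: c_def Uombar0_def Uepsbar0_def algebra_simps)
    finally show ?thesis .
  qed
  have pos: "eventually (\<lambda>th::real. 0 < th) (at_right 0)"
    by (rule eventually_at_right_less)
  show "((\<lambda>th. SUP x. \<bar>vpi M th 0 x - vopt M 0 x\<bar>) \<longlongrightarrow> 0) (at_right 0)"
  proof (rule tendsto_sandwich)
    \<comment> \<open>The uniform bound keeps the errors bounded above, so \<open>SUP\<close> is a
      genuine supremum and dominates a nonnegative member.\<close>
    show "eventually (\<lambda>th. 0 \<le> (SUP x. \<bar>vpi M th 0 x - vopt M 0 x\<bar>)) (at_right 0)"
      using pos
    proof (rule eventually_mono)
      fix th :: real assume "0 < th"
      then show "0 \<le> (SUP x. \<bar>vpi M th 0 x - vopt M 0 x\<bar>)"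
        by (intro cSUP_upper2[of _ _ 0]) (auto intro!: bdd_aboveI2 bound)
    qed
    show "eventually (\<lambda>th. (SUP x. \<bar>vpi M th 0 x - vopt M 0 x\<bar>) \<le> th * c) (at_right 0)"
      using pos by (rule eventually_mono) (auto intro!: cSUP_least bound)
    show "((\<lambda>th. th * c) \<longlongrightarrow> 0) (at_right 0)"
      by (rule tendsto_eq_intros tendsto_ident_at refl | simp)+
  qed simp
qed

end
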